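(* Let $k=2$. There is an algorithm that, given a temporal star $(G_s,L)$ on $n$ vertices in which every edge has at most $2$ labels, computes a (partial) exploration of $(G_s,L)$ of maximum size (i.e.\ solves \textsc{MaxStarExp(2)}) in $O(n\log n)$ time.
   Context: A temporal graph is a pair $(G,L)$ where $G=(V,E)$ is a graph and $L:E\to 2^{\mathbb{N}}$ assigns to each edge a set of positive integer labels (the discrete times at which the edge is available). A temporal star is a temporal graph whose underlying graph $G_s$ is a star with center $c$ and $n-1$ leaves. A time edge is a triple $(u,v,l)$ with $\{u,v\}\in E$ and $l\in L(\{u,v\})$. A journey from $u$ to $v$ is a sequence of time edges $(u,u_1,l_1),(u_1,u_2,l_2),\dots,(u_{r-1},v,l_r)$ with $l_1<l_2<\dots<l_r$. A (partial) exploration of a temporal star is a journey that starts and ends at the center $c$; its size is the number of leaves it visits (equivalently, the number of edges of the star it explores, where an edge $\{c,v\}$ is explored by entering it from $c$ to $v$ at one of its labels and later exiting it from $v$ to $c$ at a strictly larger label). The problem \textsc{MaxStarExp($k$)} takes as input a temporal star in which every edge has at most $k$ labels and asks for a (partial) exploration of maximum size. *)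

theory Defs
  imports Complex_Main
begin

text \<open>Memory is an infinite array of (unbounded) integers addressed by naturals.
  Instructions: load constant, addition, subtraction, halving, indirect load/store,
  unconditional jump and jump-if-less. The machine halts once the program counter
  leaves the program. Each executed instruction costs one time unit.\<close>

datatype instr =
    Const nat int
  | Add nat nat nat
  | Sub nat nat nat
  | Half nat nat
  | Load nat nat
  | Store nat nat
  | Jmp nat
  | Jlt nat nat nat

type_synonym config = "nat \<times> (nat \<Rightarrow> int)"

fun exec :: "instr \<Rightarrow> nat \<Rightarrow> (nat \<Rightarrow> int) \<Rightarrow> config" where
  "exec (Const r c) pc m = (Suc pc, m(r := c))"
| "exec (Add r a b) pc m = (Suc pc, m(r := m a + m b))"
| "exec (Sub r a b) pc m = (Suc pc, m(r := m a - m b))"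
| "exec (Half r a) pc m = (Suc pc, m(r := m a div 2))"
| "exec (Load r a) pc m = (Suc pc, m(r := m (nat (m a))))"
| "exec (Store a r) pc m = (Suc pc, m(nat (m a) := m r))"
| "exec (Jmp l) pc m = (l, m)"
| "exec (Jlt a b l) pc m = (if m a < m b then (l, m) else (Suc pc, m))"

definition step :: "instr list \<Rightarrow> config \<Rightarrow> config" where
  "step P c = (if fst c < length P then exec (P ! fst c) (fst c) (snd c) else c)"

definition run :: "instr list \<Rightarrow> nat \<Rightarrow> (nat \<Rightarrow> int) \<Rightarrow> config" where
  "run P t m0 = (step P ^^ t) (0, m0)"

definition halts_within :: "instr list \<Rightarrow> nat \<Rightarrow> (nat \<Rightarrow> int) \<Rightarrow> bool" where
  "halts_within P t m0 \<longleftrightarrow> length P \<le> fst (run P t m0)"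

text \<open>A temporal star on n vertices: vertex 0 is the center c, vertices 1..n-1 are the
  leaves. The label set of the edge {0,i} is L i (only i \<in> {1..<n} is relevant).\<close>

definition temporal_star_k :: "nat \<Rightarrow> (nat \<Rightarrow> nat set) \<Rightarrow> nat \<Rightarrow> bool" where
  "temporal_star_k n L k \<longleftrightarrow>
     (\<forall>i\<in>{1..<n}. finite (L i) \<and> card (L i) \<le> k \<and> (\<forall>l\<in>L i. 0 < l))"

type_synonym time_edge = "nat \<times> nat \<times> nat"

definition is_time_edge :: "nat \<Rightarrow> (nat \<Rightarrow> nat set) \<Rightarrow> time_edge \<Rightarrow> bool" where
  "is_time_edge n L e \<longleftrightarrow> (case e of (u, v, l) \<Rightarrow>
     (u = 0 \<and> v \<in> {1..<n} \<and> l \<in> L v) \<or> (v = 0 \<and> u \<in> {1..<n} \<and> l \<in> L u))"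

definition te_src :: "time_edge \<Rightarrow> nat" where "te_src e = fst e"
definition te_dst :: "time_edge \<Rightarrow> nat" where "te_dst e = fst (snd e)"
definition te_lab :: "time_edge \<Rightarrow> nat" where "te_lab e = snd (snd e)"

definition journey :: "nat \<Rightarrow> (nat \<Rightarrow> nat set) \<Rightarrow> nat \<Rightarrow> nat \<Rightarrow> time_edge list \<Rightarrow> bool" where
  "journey n L u v J \<longleftrightarrow> J \<noteq> [] \<and> (\<forall>e\<in>set J. is_time_edge n L e)
     \<and> te_src (hd J) = u \<and> te_dst (last J) = v
     \<and> (\<forall>j. Suc j < length J \<longrightarrow> te_dst (J ! j) = te_src (J ! Suc j)
                                  \<and> te_lab (J ! j) < te_lab (J ! Suc j))"

definition exploration :: "nat \<Rightarrow> (nat \<Rightarrow> nat set) \<Rightarrow> time_edge list \<Rightarrow> bool" where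
  "exploration n L J \<longleftrightarrow> J = [] \<or> journey n L 0 0 J"

definition exploration_size :: "time_edge list \<Rightarrow> nat" where
  "exploration_size J = card {v. v \<noteq> 0 \<and> (\<exists>e\<in>set J. te_dst e = v)}"

definition max_exploration :: "nat \<Rightarrow> (nat \<Rightarrow> nat set) \<Rightarrow> time_edge list \<Rightarrow> bool" where
  "max_exploration n L J \<longleftrightarrow> exploration n L J \<and>
     (\<forall>J'. exploration n L J' \<longrightarrow> exploration_size J' \<le> exploration_size J)"

text \<open>Input: cell 0 holds n; for each leaf i \<in> {1..<n}, cell 3i holds the number of
  labels of edge {c,i} and cells 3i+1, 3i+2 hold its labels in increasing order
  (0 if absent). All other cells are 0.\<close>
definition enc_input :: "nat \<Rightarrow> (nat \<Rightarrow> nat set) \<Rightarrow> nat \<Rightarrow> int" where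
  "enc_input n L a =
     (if a = 0 then int n
      else if 3 \<le> a \<and> a < 3 * n then
        (let i = a div 3; j = a mod 3; xs = sorted_list_of_set (L i) in
          if j = 0 then int (length xs)
          else if j \<le> length xs then int (xs ! (j - 1)) else 0)
      else 0)"

text \<open>Output: cell 0 holds the number r of time edges of the exploration; for j < r,
  cells 3j+1, 3j+2, 3j+3 hold source, target and label of the j-th time edge.\<close>
definition out_wellformed :: "(nat \<Rightarrow> int) \<Rightarrow> bool" where
  "out_wellformed m \<longleftrightarrow> (\<forall>a \<le> 3 * nat (m 0). 0 \<le> m a)"

definition dec_output :: "(nat \<Rightarrow> int) \<Rightarrow> time_edge list" where
  "dec_output m = map (\<lambda>j. (nat (m (3*j+1)), nat (m (3*j+2)), nat (m (3*j+3)))) [0..<nat (m 0)]"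

end

theory Submission
  imports Defs
begin

text \<open>A leaf can be visited only if its edge has two labels \<open>s < e\<close>, and then it blocks the time
  interval from \<open>s\<close> to \<open>e\<close>; so an optimal exploration is a maximum set of pairwise disjoint closed
  intervals. Going through the intervals by decreasing \<open>s\<close> and accepting each one that ends before
  the earliest accepted start is optimal. A tournament tree delivers the intervals in this order:
  its root is the interval with the largest key, and after the key of a leaf is set to \<open>0\<close> only the
  \<open>O(log n)\<close> nodes above it are recomputed. Any \<open>n\<close> works, not only powers of two, with the leaves at
  \<open>n..<2 * n\<close> and the children of \<open>p\<close> at \<open>2 * p\<close> and \<open>2 * p + 1\<close>. Processing by decreasing start
  makes \<open>0\<close> available as the key of a removed interval, so no infinite key is needed.\<close>

section \<open>Structured programs with running times\<close>

text \<open>The machine has only jumps for control and one memory shared by input, registers and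
  output, and this shapes the proof. Jumps are avoided by writing the algorithm in a small
  structured language whose compiled form takes exactly the counted number of steps. The memory
  conflict arises because input and output both occupy the cells from 0 upwards, where registers are
  needed as well; so the input is moved up, the exploration is assembled above the tree and moved
  down only when it is complete. Taking the intervals by decreasing start fits this layout: an
  accepted leaf contributes two time edges that precede all earlier ones, so a stack growing
  downwards holds the exploration in chronological order. An edge with a single label takes part in
  the tournament and is rejected at the root; an edge without labels has key \<open>0\<close> and is
  never processed.\<close>

datatype com =
    Blk "instr list"
  | Seq com com
  | Cond nat nat com com
  | Loop nat nat com

fun basic :: "instr \<Rightarrow> bool" where
  "basic (Jmp l) = False"
| "basic (Jlt a b l) = False"
| "basic _ = True"

definition effect :: "instr list \<Rightarrow> (nat \<Rightarrow> int) \<Rightarrow> nat \<Rightarrow> int" where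
  "effect is m = fold (\<lambda>i m. snd (exec i 0 m)) is m"

lemma effect_simps [simp]:
  "effect [] m = m"
  "effect (i # is) m = effect is (snd (exec i 0 m))"
  "effect (is @ js) m = effect js (effect is m)"
  by (simp_all add: effect_def)

text \<open>The costs are those of the code laid out by \<open>compile\<close>: the else branch
  comes first, so the then branch costs only the test, while the else branch also pays for the jump
  over its sibling. A loop round pays for the test and the jump back.\<close>

inductive big_step :: "com \<Rightarrow> (nat \<Rightarrow> int) \<Rightarrow> nat \<Rightarrow> (nat \<Rightarrow> int) \<Rightarrow> bool" where
  Blk: "list_all basic is \<Longrightarrow> big_step (Blk is) m (length is) (effect is m)"
| Seq: "big_step c m t m' \<Longrightarrow> big_step d m' u m'' \<Longrightarrow> big_step (Seq c d) m (t + u) m''"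
| CondT: "m a < m b \<Longrightarrow> big_step c m t m' \<Longrightarrow> big_step (Cond a b c d) m (Suc t) m'"
| CondF: "\<not> m a < m b \<Longrightarrow> big_step d m t m' \<Longrightarrow> big_step (Cond a b c d) m (t + 2) m'"
| LoopF: "\<not> m a < m b \<Longrightarrow> big_step (Loop a b c) m 2 m"
| LoopT: "m a < m b \<Longrightarrow> big_step c m t m' \<Longrightarrow> big_step (Loop a b c) m' u m'' \<Longrightarrow>
    big_step (Loop a b c) m (t + 2 + u) m''"

fun csize :: "com \<Rightarrow> nat" where
  "csize (Blk is) = length is"
| "csize (Seq c d) = csize c + csize d"
| "csize (Cond a b c d) = csize c + csize d + 2"
| "csize (Loop a b c) = csize c + 3"

fun compile :: "com \<Rightarrow> nat \<Rightarrow> instr list" where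
  "compile (Blk is) pc = is"
| "compile (Seq c d) pc = compile c pc @ compile d (pc + csize c)"
| "compile (Cond a b c d) pc =
     Jlt a b (pc + csize d + 2) # compile d (pc + 1) @ Jmp (pc + csize c + csize d + 2) #
     compile c (pc + csize d + 2)"
| "compile (Loop a b c) pc =
     Jlt a b (pc + 2) # Jmp (pc + csize c + 3) # compile c (pc + 2) @ [Jmp pc]"

lemma length_compile [simp]: "length (compile c pc) = csize c"
  by (induction c arbitrary: pc) auto

lemma step_at:
  assumes "P = pre @ i # post"
  shows "step P (length pre, m) = exec i (length pre) m"
  using assms by (simp add: step_def)

lemma exec_basic: "basic i \<Longrightarrow> exec i pc m = (Suc pc, snd (exec i 0 m))"
  by (cases i) auto

lemma funpow_add_apply: "(f ^^ (t + u)) x = (f ^^ u) ((f ^^ t) x)"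
  by (subst add.commute) (simp add: funpow_add)

lemma funpow_one_apply: "(f ^^ 1) x = f x" for f :: "'a \<Rightarrow> 'a"
  by simp

lemma steps_block:
  assumes "list_all basic is" "P = pre @ is @ post"
  shows "(step P ^^ length is) (length pre, m) = (length pre + length is, effect is m)"
  using assms
proof (induction "is" arbitrary: pre m)
  case (Cons i "is")
  have s: "step P (length pre, m) = (Suc (length pre), snd (exec i 0 m))"
    using step_at[of P pre i "is @ post" m] exec_basic[of i "length pre" m] Cons.prems by simp
  show ?case
    using Cons.IH[of "pre @ [i]" "snd (exec i 0 m)"] Cons.prems s
    by (simp add: funpow_swap1)
qed simp

text \<open>\<open>pre\<close> and \<open>post\<close> stay arbitrary in the induction: the
  components of a compound command are surrounded by its own jumps, and jump targets are absolute,
  so the start address has to be the real one.\<close>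

lemma compile_correct:
  assumes "big_step c m t m'" "P = pre @ compile c (length pre) @ post"
  shows "(step P ^^ t) (length pre, m) = (length pre + csize c, m')"
  using assms
proof (induction arbitrary: pre post rule: big_step.induct)
  case (Blk "is" m)
  then show ?case using steps_block by simp
next
  case (Seq c m t m' d u m'')
  show ?case
    using Seq.IH(1)[of pre "compile d (length pre + csize c) @ post"]
      Seq.IH(2)[of "pre @ compile c (length pre)" post] Seq.prems
    by (simp add: funpow_add_apply add.assoc)
next
  case (CondT m a b c t m' d)
  let ?pre = "pre @ Jlt a b (length pre + csize d + 2) # compile d (length pre + 1) @
    [Jmp (length pre + csize c + csize d + 2)]"
  have l: "length ?pre = length pre + csize d + 2" by simp
  have s: "step P (length pre, m) = (length ?pre, m)"
    using step_at[of P pre "Jlt a b (length pre + csize d + 2)"] CondT.prems CondT.hyps l by simp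
  show ?case
    using CondT.IH[of ?pre post] CondT.prems s unfolding l
    by (simp add: funpow_swap1 algebra_simps)
next
  case (CondF m a b d t m' c)
  let ?pre = "pre @ [Jlt a b (length pre + csize d + 2)]"
  have s: "step P (length pre, m) = (length ?pre, m)"
    using step_at[of P pre "Jlt a b (length pre + csize d + 2)"] CondF.prems CondF.hyps by simp
  have s2: "step P (length ?pre + csize d, m') = (length pre + csize c + csize d + 2, m')"
    using step_at[of P "?pre @ compile d (length pre + 1)" "Jmp (length pre + csize c + csize d + 2)"
      "compile c (length pre + csize d + 2) @ post" m'] CondF.prems by simp
  have "(step P ^^ t) (length ?pre, m) = (length ?pre + csize d, m')"
    using CondF.IH[of ?pre] CondF.prems by simp
  then have "(step P ^^ (1 + t + 1)) (length pre, m) = (length pre + csize c + csize d + 2, m')"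
    by (simp only: funpow_add_apply funpow_one_apply s s2)
  then show ?case by (simp add: numeral_2_eq_2 add.assoc)
next
  case (LoopF m a b c)
  have s: "step P (length pre, m) = (Suc (length pre), m)"
    using step_at[of P pre "Jlt a b (length pre + 2)"] LoopF by simp
  have "step P (Suc (length pre), m) = (length pre + csize c + 3, m)"
    using step_at[of P "pre @ [Jlt a b (length pre + 2)]" "Jmp (length pre + csize c + 3)"
      "compile c (length pre + 2) @ Jmp (length pre) # post" m]
      LoopF by simp
  then show ?case using s by (simp add: numeral_2_eq_2)
next
  case (LoopT m a b c t m' u m'')
  let ?pre = "pre @ [Jlt a b (length pre + 2), Jmp (length pre + csize c + 3)]"
  have s: "step P (length pre, m) = (length ?pre, m)"
    using step_at[of P pre "Jlt a b (length pre + 2)"] LoopT.prems LoopT.hyps by simp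
  have s2: "step P (length ?pre + csize c, m') = (length pre, m')"
    using step_at[of P "?pre @ compile c (length pre + 2)" "Jmp (length pre)" post m'] LoopT.prems
    by simp
  have i1: "(step P ^^ t) (length ?pre, m) = (length ?pre + csize c, m')"
    using LoopT.IH(1)[of ?pre "Jmp (length pre) # post"] LoopT.prems by simp
  have "(step P ^^ (1 + t + 1 + u)) (length pre, m) = (length pre + csize (Loop a b c), m'')"
    using LoopT.IH(2)[OF LoopT.prems] by (simp only: funpow_add_apply funpow_one_apply s s2 i1)
  then show ?case by (simp add: numeral_2_eq_2 add.assoc)
qed

section \<open>Total correctness with an upper bound on the number of steps\<close>

definition ensures :: "com \<Rightarrow> (nat \<Rightarrow> int) \<Rightarrow> nat \<Rightarrow> ((nat \<Rightarrow> int) \<Rightarrow> bool) \<Rightarrow> bool" where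
  "ensures c m T Q \<longleftrightarrow> (\<exists>t m'. big_step c m t m' \<and> t \<le> T \<and> Q m')"

lemma ensures_mono:
  assumes "ensures c m T Q" "T \<le> T'" "\<And>m'. Q m' \<Longrightarrow> Q' m'"
  shows "ensures c m T' Q'"
  using assms unfolding ensures_def by (meson order_trans)

lemma ensures_Blk:
  assumes "list_all basic is" "length is \<le> T" "Q (effect is m)"
  shows "ensures (Blk is) m T Q"
  using assms unfolding ensures_def by (blast intro: big_step.Blk)

lemma ensures_Blk_eq:
  assumes "m' = effect is m" "list_all basic is" "length is \<le> T" "Q m'"
  shows "ensures (Blk is) m T Q"
  using assms by (blast intro: ensures_Blk)

lemma ensures_Seq:
  assumes "ensures c m T R" "\<And>m'. R m' \<Longrightarrow> ensures d m' U Q" "T + U \<le> V"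
  shows "ensures (Seq c d) m V Q"
proof -
  obtain t m' where 1: "big_step c m t m'" "t \<le> T" "R m'"
    using assms(1) unfolding ensures_def by blast
  then obtain u m'' where 2: "big_step d m' u m''" "u \<le> U" "Q m''"
    using assms(2) unfolding ensures_def by blast
  have "big_step (Seq c d) m (t + u) m''" using 1 2 by (blast intro: big_step.Seq)
  moreover have "t + u \<le> V" using 1 2 assms(3) by linarith
  ultimately show ?thesis using 2 unfolding ensures_def by blast
qed

lemma ensures_Cond:
  assumes "m a < m b \<Longrightarrow> ensures c m T Q" "\<not> m a < m b \<Longrightarrow> ensures d m T Q" "T + 2 \<le> V"
  shows "ensures (Cond a b c d) m V Q"
proof (cases "m a < m b")
  case True
  then obtain t m' where 1: "big_step c m t m'" "t \<le> T" "Q m'"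
    using assms(1) unfolding ensures_def by blast
  have "big_step (Cond a b c d) m (Suc t) m'" using 1 True by (blast intro: big_step.CondT)
  moreover have "Suc t \<le> V" using 1 assms(3) by linarith
  ultimately show ?thesis using 1 unfolding ensures_def by blast
next
  case False
  then obtain t m' where 1: "big_step d m t m'" "t \<le> T" "Q m'"
    using assms(2) unfolding ensures_def by blast
  have "big_step (Cond a b c d) m (t + 2) m'" using 1 False by (blast intro: big_step.CondF)
  moreover have "t + 2 \<le> V" using 1 assms(3) by linarith
  ultimately show ?thesis using 1 unfolding ensures_def by blast
qed

text \<open>\<open>I k\<close> bounds the remaining rounds by \<open>k\<close>, which gives
  termination and running time at once. The two extra steps per round are the test and the jump
  back, the final two are the failing test and the exit jump.\<close>

lemma ensures_Loop:
  assumes "I k m"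
    and "\<And>k m. I k m \<Longrightarrow> m a < m b \<Longrightarrow> 0 < k \<and> ensures c m T (I (k - 1))"
    and "k * (T + 2) + 2 \<le> V"
    and "\<And>k m. I k m \<Longrightarrow> \<not> m a < m b \<Longrightarrow> Q m"
  shows "ensures (Loop a b c) m V Q"
proof -
  have "\<exists>t m'. big_step (Loop a b c) m t m' \<and> t \<le> k * (T + 2) + 2 \<and> Q m'"
    using assms(1)
  proof (induction k arbitrary: m)
    case 0
    then have "\<not> m a < m b" using assms(2) by blast
    then show ?case using big_step.LoopF[of m a b c] assms(4)[OF 0] by (intro exI[of _ 2]) auto
  next
    case (Suc k)
    show ?case
    proof (cases "m a < m b")
      case True
      then obtain t m' where 1: "big_step c m t m'" "t \<le> T" "I k m'"
        using assms(2)[OF Suc.prems] unfolding ensures_def by auto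
      then obtain u m'' where 2: "big_step (Loop a b c) m' u m''" "u \<le> k * (T + 2) + 2" "Q m''"
        using Suc.IH by blast
      have "big_step (Loop a b c) m (t + 2 + u) m''"
        using 1 2 True by (blast intro: big_step.LoopT)
      moreover have "t + 2 + u \<le> Suc k * (T + 2) + 2" using 1 2 by simp
      ultimately show ?thesis using 2 by blast
    next
      case False
      then show ?thesis
        using big_step.LoopF[of m a b c] assms(4)[OF Suc.prems] by (intro exI[of _ 2]) auto
    qed
  qed
  then show ?thesis using assms(3) unfolding ensures_def by (meson order_trans)
qed

lemma ensures_run:
  assumes "ensures c m T Q"
  shows "\<exists>t\<le>T. halts_within (compile c 0) t m \<and> Q (snd (run (compile c 0) t m))"
proof -
  obtain t m' where 1: "big_step c m t m'" "t \<le> T" "Q m'"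
    using assms unfolding ensures_def by blast
  have "run (compile c 0) t m = (csize c, m')"
    using compile_correct[OF 1(1), of "compile c 0" "[]" "[]"] by (simp add: run_def)
  then show ?thesis using 1 by (auto simp: halts_within_def)
qed

section \<open>Greedy explorations of stars with two labels per edge\<close>

text \<open>The labels are read off the encoded input, so they agree with the memory cells including
  the default \<open>0\<close>. Since true labels are positive, \<open>0 < sndlab n L i\<close> says
  that leaf \<open>i\<close> can be visited; the center counts as a leaf with both labels
  \<open>0\<close>.\<close>

definition fstlab :: "nat \<Rightarrow> (nat \<Rightarrow> nat set) \<Rightarrow> nat \<Rightarrow> nat" where
  "fstlab n L i = nat (enc_input n L (3 * i + 1))"

definition sndlab :: "nat \<Rightarrow> (nat \<Rightarrow> nat set) \<Rightarrow> nat \<Rightarrow> nat" where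
  "sndlab n L i = nat (enc_input n L (3 * i + 2))"

lemma enc_input_nonneg: "0 \<le> enc_input n L a"
  by (simp add: enc_input_def Let_def)

lemma enc_input_labels:
  "enc_input n L (3 * i + 1) = int (fstlab n L i)"
  "enc_input n L (3 * i + 2) = int (sndlab n L i)"
  by (simp_all add: fstlab_def sndlab_def enc_input_nonneg)

lemma labels_0: "fstlab n L 0 = 0" "sndlab n L 0 = 0"
  by (simp_all add: fstlab_def sndlab_def enc_input_def)

lemma div_mod_3 [simp]:
  "Suc (3 * i) div 3 = i" "Suc (3 * i) mod 3 = 1" "Suc (Suc (3 * i)) div 3 = i"
  "Suc (Suc (3 * i)) mod 3 = 2"
  by presburger+

lemma labels_eq:
  assumes "i \<in> {1..<n}"
  shows "fstlab n L i = (let xs = sorted_list_of_set (L i) in if 1 \<le> length xs then xs ! 0 else 0)"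
    "sndlab n L i = (let xs = sorted_list_of_set (L i) in if 2 \<le> length xs then xs ! 1 else 0)"
  using assms by (auto simp: fstlab_def sndlab_def enc_input_def Let_def)

lemma labels_pair:
  assumes "i \<in> {1..<n}" "L i = {a, b}" "a < b"
  shows "fstlab n L i = a" "sndlab n L i = b"
proof -
  have "sorted_list_of_set (L i) = [a, b]"
    using assms by (intro sorted_distinct_set_unique) auto
  then show "fstlab n L i = a" "sndlab n L i = b" using labels_eq[OF assms(1), of L] by auto
qed

lemma labels_valid:
  assumes "temporal_star_k n L 2" "i < n" "0 < sndlab n L i"
  shows "i \<in> {1..<n}" "L i = {fstlab n L i, sndlab n L i}" "0 < fstlab n L i"
    "fstlab n L i < sndlab n L i"
proof -
  show i: "i \<in> {1..<n}" using assms labels_0 by (cases i) auto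
  have f: "finite (L i)" "card (L i) \<le> 2" "\<forall>l\<in>L i. 0 < l"
    using assms(1) i by (auto simp: temporal_star_k_def)
  have "2 \<le> card (L i)"
    using assms(3) labels_eq(2)[OF i, of L] f by (auto simp: Let_def split: if_splits)
  then obtain a b where ab: "L i = {a, b}" "a < b"
    using f card_2_iff[of "L i"] by (metis insert_commute le_antisym linorder_neqE_nat)
  then show "L i = {fstlab n L i, sndlab n L i}" "0 < fstlab n L i" "fstlab n L i < sndlab n L i"
    using labels_pair[of i n L a b] i ab f(3) by auto
qed

section \<open>Explorations as families of disjoint intervals\<close>

definition visited :: "time_edge list \<Rightarrow> nat set" where
  "visited J = {v. v \<noteq> 0 \<and> (\<exists>e\<in>set J. te_dst e = v)}"

definition feasible :: "nat \<Rightarrow> (nat \<Rightarrow> nat set) \<Rightarrow> nat set \<Rightarrow> bool" where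
  "feasible n L F \<longleftrightarrow> finite F \<and> (\<forall>f\<in>F. f < n \<and> 0 < sndlab n L f) \<and>
     (\<forall>f\<in>F. \<forall>g\<in>F. f \<noteq> g \<longrightarrow> sndlab n L f < fstlab n L g \<or> sndlab n L g < fstlab n L f)"

lemma finite_visited [simp]: "finite (visited J)"
proof -
  have "visited J \<subseteq> te_dst ` set J" by (auto simp: visited_def)
  then show ?thesis by (rule finite_subset) simp
qed

lemma exploration_size_visited: "exploration_size J = card (visited J)"
  by (simp add: exploration_size_def visited_def)

text \<open>An arrival at a leaf is followed by the departure over the same edge, and two increasing
  labels exhaust a label set of size at most two; so a visit occupies exactly the interval between
  the two labels. Visits of different leaves use separate pairs of positions in the journey, hence
  disjoint intervals.\<close>

lemma visited_feasible:
  assumes star: "temporal_star_k n L 2" and "exploration n L J"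
  shows "feasible n L (visited J)"
proof (cases "J = []")
  case True
  then show ?thesis by (simp add: feasible_def visited_def)
next
  case False
  then have J: "\<And>e. e \<in> set J \<Longrightarrow> is_time_edge n L e" "te_dst (last J) = 0"
    "\<And>j. Suc j < length J \<Longrightarrow> te_dst (J ! j) = te_src (J ! Suc j)"
    "\<And>j. Suc j < length J \<Longrightarrow> te_lab (J ! j) < te_lab (J ! Suc j)"
    using assms(2) by (auto simp: exploration_def journey_def)
  have mono: "te_lab (J ! i) < te_lab (J ! j)" if "i < j" "j < length J" for i j
    using that
  proof (induction j)
    case (Suc j)
    then show ?case using J(4)[of j] by (cases "i = j") (auto intro: less_trans)
  qed simp
  have visit: "\<exists>j. Suc j < length J \<and> te_dst (J ! j) = v \<and> te_dst (J ! Suc j) = 0 \<and> v < n \<and>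
      0 < sndlab n L v \<and> te_lab (J ! j) = fstlab n L v \<and> te_lab (J ! Suc j) = sndlab n L v"
    if "v \<in> visited J" for v
  proof -
    obtain j where j: "j < length J" "te_dst (J ! j) = v" "v \<noteq> 0"
      using \<open>v \<in> visited J\<close> by (auto simp: visited_def in_set_conv_nth)
    have sj: "Suc j < length J"
    proof (rule ccontr)
      assume "\<not> Suc j < length J"
      then have "J ! j = last J" using j(1) False by (metis Suc_lessI diff_Suc_1 last_conv_nth)
      then show False using J(2) j by simp
    qed
    have e1: "v \<in> {1..<n}" "te_lab (J ! j) \<in> L v"
      using J(1)[of "J ! j"] j by (auto simp: is_time_edge_def te_dst_def te_lab_def split: prod.splits)
    have e2: "te_dst (J ! Suc j) = 0" "te_lab (J ! Suc j) \<in> L v"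
      using J(1)[of "J ! Suc j"] J(3)[OF sj] j sj
      by (auto simp: is_time_edge_def te_dst_def te_lab_def te_src_def split: prod.splits)
    let ?a = "te_lab (J ! j)" and ?b = "te_lab (J ! Suc j)"
    have f: "finite (L v)" "card (L v) \<le> 2"
      using star e1 by (auto simp: temporal_star_k_def)
    have lt: "?a < ?b" using J(4)[OF sj] .
    have "{?a, ?b} = L v"
      using e1 e2 f lt by (intro card_seteq) auto
    then have "fstlab n L v = ?a" "sndlab n L v = ?b"
      using labels_pair[OF e1(1) _ lt, of L] by auto
    then show ?thesis using sj j e1 e2 lt by auto
  qed
  have "sndlab n L v < fstlab n L w \<or> sndlab n L w < fstlab n L v"
    if "v \<in> visited J" "w \<in> visited J" "v \<noteq> w" for v w
  proof -
    obtain i where i: "Suc i < length J" "te_dst (J ! i) = v" "te_dst (J ! Suc i) = 0"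
      "te_lab (J ! i) = fstlab n L v" "te_lab (J ! Suc i) = sndlab n L v"
      using visit[OF \<open>v \<in> visited J\<close>] by blast
    obtain j where j: "Suc j < length J" "te_dst (J ! j) = w" "te_dst (J ! Suc j) = 0"
      "te_lab (J ! j) = fstlab n L w" "te_lab (J ! Suc j) = sndlab n L w"
      using visit[OF \<open>w \<in> visited J\<close>] by blast
    have nz: "v \<noteq> 0" "w \<noteq> 0" using that by (auto simp: visited_def)
    \<comment> \<open>Time edge \<open>Suc i\<close> ends at the center and time edge
      \<open>j\<close> at a leaf, so the two pairs of positions cannot overlap by one
      either.\<close>
    have "i \<noteq> j" "Suc i \<noteq> j" "Suc j \<noteq> i" using i j nz that by auto
    then consider "Suc i < j" | "Suc j < i" by linarith
    then show ?thesis using mono[of "Suc i" j] mono[of "Suc j" i] i j by cases auto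
  qed
  then show ?thesis using visit by (auto simp: feasible_def)
qed

lemma exploration_Cons2:
  assumes "temporal_star_k n L 2" "exploration n L J" "i < n" "0 < sndlab n L i"
    and "\<forall>e\<in>set J. sndlab n L i < te_lab e"
  shows "exploration n L ((0, i, fstlab n L i) # (i, 0, sndlab n L i) # J)"
proof -
  note v = labels_valid[OF assms(1,3,4)]
  let ?e = "(0, i, fstlab n L i)" and ?f = "(i, 0, sndlab n L i)"
  have e: "is_time_edge n L ?e" "is_time_edge n L ?f"
    using v(1) by (auto simp: is_time_edge_def intro: v(2)[THEN equalityD2, THEN subsetD])
  have J: "\<forall>e\<in>set J. is_time_edge n L e" "J \<noteq> [] \<Longrightarrow> te_dst (last J) = 0"
    "J \<noteq> [] \<Longrightarrow> te_src (hd J) = 0"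
    "\<And>j. Suc j < length J \<Longrightarrow> te_dst (J ! j) = te_src (J ! Suc j) \<and> te_lab (J ! j) < te_lab (J ! Suc j)"
    using assms(2) by (auto simp: exploration_def journey_def)
  have "te_dst ((?e # ?f # J) ! j) = te_src ((?e # ?f # J) ! Suc j) \<and>
      te_lab ((?e # ?f # J) ! j) < te_lab ((?e # ?f # J) ! Suc j)"
    if "Suc j < length (?e # ?f # J)" for j
  proof -
    consider "j = 0" | "j = 1" | k where "j = Suc (Suc k)"
      by (metis One_nat_def not0_implies_Suc)
    then show ?thesis
    proof cases
      case 1
      then show ?thesis using v(4) by (simp add: te_dst_def te_src_def te_lab_def)
    next
      case 2
      then have "J \<noteq> []" using that by auto
      then show ?thesis using 2 J(3) assms(5)
        by (cases J) (auto simp: te_dst_def te_src_def te_lab_def)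
    next
      case 3
      then show ?thesis using J(4)[of k] that by simp
    qed
  qed
  then show ?thesis
    using e J unfolding exploration_def journey_def
    by (auto simp: te_src_def te_dst_def)
qed

lemma visited_Cons2: "i \<noteq> 0 \<Longrightarrow> visited ((0, i, a) # (i, 0, b) # J) = insert i (visited J)"
  by (auto simp: visited_def te_dst_def)

text \<open>\<open>D\<close> is the set of leaves processed so far, \<open>J\<close> the exploration built from them and \<open>x\<close> its
  starting time (or the bound \<open>X\<close> while \<open>J\<close> is empty). The last conjunct is the usual
  greedy-stays-ahead property, phrased so that it also makes sense for empty families.\<close>
definition greedy :: "nat \<Rightarrow> (nat \<Rightarrow> nat set) \<Rightarrow> nat \<Rightarrow> nat set \<Rightarrow> time_edge list \<Rightarrow> nat \<Rightarrow> bool" where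
  "greedy n L X D J x \<longleftrightarrow> D \<subseteq> {..<n} \<and> exploration n L J \<and> visited J \<subseteq> D \<and>
     length J = 2 * card (visited J) \<and> (\<forall>e\<in>set J. x \<le> te_lab e) \<and>
     (\<forall>i<n. i \<notin> D \<longrightarrow> (\<forall>j\<in>D. fstlab n L i \<le> fstlab n L j)) \<and>
     (x = X \<or> (\<exists>j\<in>D. x = fstlab n L j)) \<and>
     (\<forall>F\<subseteq>D. feasible n L F \<longrightarrow> card F < card (visited J) \<or>
        (card F = card (visited J) \<and> (\<forall>y<X. (\<forall>f\<in>F. y < fstlab n L f) \<longrightarrow> y < x)))"

lemma greedyD:
  assumes "greedy n L X D J x"
  shows "D \<subseteq> {..<n}" "exploration n L J" "visited J \<subseteq> D" "length J = 2 * card (visited J)"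
    "\<And>e. e \<in> set J \<Longrightarrow> x \<le> te_lab e"
    "\<And>i j. i < n \<Longrightarrow> i \<notin> D \<Longrightarrow> j \<in> D \<Longrightarrow> fstlab n L i \<le> fstlab n L j"
    "x = X \<or> (\<exists>j\<in>D. x = fstlab n L j)"
    "\<And>F. F \<subseteq> D \<Longrightarrow> feasible n L F \<Longrightarrow> card F < card (visited J) \<or>
        (card F = card (visited J) \<and> (\<forall>y<X. (\<forall>f\<in>F. y < fstlab n L f) \<longrightarrow> y < x))"
  using assms unfolding greedy_def by simp_all

lemma greedy_empty: "greedy n L X {} [] X"
  by (auto simp: greedy_def exploration_def visited_def)

section \<open>Greedy stays ahead\<close>

lemma feasible_subset: "feasible n L F \<Longrightarrow> G \<subseteq> F \<Longrightarrow> feasible n L G"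
  by (auto simp: feasible_def intro: finite_subset)

text \<open>The first label of \<open>j\<close> is minimal on \<open>insert j D\<close>, so
  disjointness forces the rest of \<open>F\<close> to start after \<open>j\<close> ends. Taking the
  second label of \<open>j\<close> for \<open>y\<close> in the last conjunct of
  \<open>greedy\<close> then compares this end with \<open>x\<close>; as \<open>X\<close> exceeds
  every second label, this \<open>y\<close> is admissible even if \<open>F\<close> contains nothing
  but \<open>j\<close>.\<close>

lemma feasible_insert_latest:
  assumes star: "temporal_star_k n L 2" and g: "greedy n L X D J x"
    and j: "j < n" "j \<notin> D" and F: "F \<subseteq> insert j D" "feasible n L F" "j \<in> F"
    and X: "\<forall>i<n. sndlab n L i < X"
  shows "0 < sndlab n L j" "card F \<le> card (visited J) \<or> sndlab n L j < x \<and> card F = Suc (card (visited J))"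
proof -
  show v: "0 < sndlab n L j" using F by (auto simp: feasible_def)
  let ?G = "F - {j}"
  have G: "?G \<subseteq> D" "feasible n L ?G" using F feasible_subset[of n L F ?G] by auto
  have cF: "card F = Suc (card ?G)" using F card_Suc_Diff1[of F j] by (simp add: feasible_def)
  have ahead: "card ?G < card (visited J) \<or> (card ?G = card (visited J) \<and>
      (\<forall>y<X. (\<forall>f\<in>?G. y < fstlab n L f) \<longrightarrow> y < x))"
    using greedyD(8)[OF g G] .
  have "sndlab n L j < fstlab n L f" if "f \<in> ?G" for f
  proof -
    have "fstlab n L j \<le> fstlab n L f" using greedyD(6)[OF g j] G(1) that by blast
    moreover have "fstlab n L f < sndlab n L f"
      using labels_valid(4)[OF star] G(2) that by (auto simp: feasible_def)
    moreover have "sndlab n L j < fstlab n L f \<or> sndlab n L f < fstlab n L j"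
      using F that by (auto simp: feasible_def)
    ultimately show ?thesis by linarith
  qed
  then show "card F \<le> card (visited J) \<or> sndlab n L j < x \<and> card F = Suc (card (visited J))"
    using ahead X j cF by auto
qed

lemma greedy_reject:
  assumes star: "temporal_star_k n L 2" and g: "greedy n L X D J x"
    and j: "j < n" "j \<notin> D" "\<forall>i<n. i \<notin> D \<longrightarrow> fstlab n L i \<le> fstlab n L j"
    and X: "\<forall>i<n. sndlab n L i < X"
    and no: "\<not> (0 < sndlab n L j \<and> sndlab n L j < x)"
  shows "greedy n L X (insert j D) J x"
proof -
  have "card F < card (visited J) \<or> (card F = card (visited J) \<and>
      (\<forall>y<X. (\<forall>f\<in>F. y < fstlab n L f) \<longrightarrow> y < x))"
    if F: "F \<subseteq> insert j D" "feasible n L F" for F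
  proof (cases "j \<in> F")
    case True
    note l = feasible_insert_latest[OF star g j(1,2) F True X]
    \<comment> \<open>Needed when \<open>F\<close> has as many elements as \<open>J\<close> visits
      leaves: a \<open>y\<close> before all intervals of \<open>F\<close> lies below the first label
      of \<open>j\<close>, hence below \<open>x\<close>.\<close>
    have "fstlab n L j \<le> x"
    proof (cases "x = X")
      case True
      then show ?thesis using labels_valid(4)[OF star j(1) l(1)] X j(1) by force
    next
      case False
      then show ?thesis using greedyD(6)[OF g j(1,2)] greedyD(7)[OF g] by auto
    qed
    then show ?thesis using l no True by (meson le_neq_implies_less less_le_trans)
  next
    case False
    then have "F \<subseteq> D" using F by auto
    then show ?thesis using greedyD(8)[OF g _ F(2)] by blast
  qed
  moreover have "\<forall>i<n. i \<notin> insert j D \<longrightarrow> (\<forall>k\<in>insert j D. fstlab n L i \<le> fstlab n L k)"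
    using greedyD(6)[OF g] j by auto
  ultimately show ?thesis
    using greedyD(1-5,7)[OF g] j unfolding greedy_def by (intro conjI) auto
qed

text \<open>Families without \<open>j\<close> fall behind because the count grows. For those with
  \<open>j\<close> the new starting time is the first label of \<open>j\<close>, so every
  \<open>y\<close> below all their starts is below it.\<close>

lemma greedy_accept:
  assumes star: "temporal_star_k n L 2" and g: "greedy n L X D J x"
    and j: "j < n" "j \<notin> D" "\<forall>i<n. i \<notin> D \<longrightarrow> fstlab n L i \<le> fstlab n L j"
    and X: "\<forall>i<n. sndlab n L i < X"
    and yes: "0 < sndlab n L j" "sndlab n L j < x"
  shows "greedy n L X (insert j D) ((0, j, fstlab n L j) # (j, 0, sndlab n L j) # J) (fstlab n L j)"
    (is "greedy n L X _ ?J _")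
proof -
  note v = labels_valid[OF star j(1) yes(1)]
  have vis: "visited ?J = insert j (visited J)" using v(1) visited_Cons2 by simp
  have "j \<notin> visited J" using greedyD(3)[OF g] j by blast
  then have card: "card (visited ?J) = Suc (card (visited J))" using vis by simp
  have labs: "\<forall>e\<in>set J. sndlab n L j < te_lab e"
    using greedyD(5)[OF g] yes(2) by (meson less_le_trans)
  have ex: "exploration n L ?J"
    using exploration_Cons2[OF star greedyD(2)[OF g] j(1) yes(1) labs] .
  have "card F < card (visited ?J) \<or> (card F = card (visited ?J) \<and>
      (\<forall>y<X. (\<forall>f\<in>F. y < fstlab n L f) \<longrightarrow> y < fstlab n L j))"
    if F: "F \<subseteq> insert j D" "feasible n L F" for F
  proof (cases "j \<in> F")
    case True
    then show ?thesis using feasible_insert_latest[OF star g j(1,2) F True X] card by auto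
  next
    case False
    then have "F \<subseteq> D" using F by auto
    then have "card F \<le> card (visited J)" using greedyD(8)[OF g _ F(2)] by fastforce
    then show ?thesis using card by simp
  qed
  moreover have "\<forall>e\<in>set ?J. fstlab n L j \<le> te_lab e"
    using labs v(4) by (auto simp: te_lab_def)
  moreover have "\<forall>i<n. i \<notin> insert j D \<longrightarrow> (\<forall>k\<in>insert j D. fstlab n L i \<le> fstlab n L k)"
    using greedyD(6)[OF g] j by auto
  ultimately show ?thesis
    using greedyD(1,3,4)[OF g] j ex vis card unfolding greedy_def by (intro conjI) auto
qed

text \<open>A leaf that can be visited has a positive first label. So every exploration visits only
  leaves in \<open>D\<close>, where \<open>J\<close> is known to be largest.\<close>

lemma greedy_optimal:
  assumes star: "temporal_star_k n L 2" and g: "greedy n L X D J x"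
    and all: "\<forall>i<n. i \<notin> D \<longrightarrow> fstlab n L i = 0"
  shows "max_exploration n L J"
proof -
  have "exploration_size J' \<le> exploration_size J" if "exploration n L J'" for J'
  proof -
    have f: "feasible n L (visited J')" using visited_feasible[OF star that] .
    have "visited J' \<subseteq> D"
    proof
      fix v assume "v \<in> visited J'"
      then have "v < n" "0 < sndlab n L v" using f by (auto simp: feasible_def)
      then show "v \<in> D" using labels_valid(3)[OF star] all by fastforce
    qed
    then have "card (visited J') \<le> card (visited J)"
      using greedyD(8)[OF g _ f] by fastforce
    then show ?thesis by (simp add: exploration_size_visited)
  qed
  then show ?thesis using g by (simp add: max_exploration_def greedy_def)
qed

section \<open>Tournament trees\<close>

definition key :: "int \<times> int \<times> int \<Rightarrow> int" where
  "key r = fst (snd r)"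

definition winner :: "(nat \<Rightarrow> int \<times> int \<times> int) \<Rightarrow> nat \<Rightarrow> int \<times> int \<times> int" where
  "winner T p = (if key (T (2 * p)) < key (T (2 * p + 1)) then T (2 * p + 1) else T (2 * p))"

text \<open>The nodes of the tournament tree are \<open>{1..<2 * n}\<close>, the leaves are \<open>{n..<2 * n}\<close>;
  nodes in \<open>A\<close> are exempt from the requirement.\<close>
definition tournament :: "nat \<Rightarrow> (nat \<Rightarrow> int \<times> int \<times> int) \<Rightarrow> nat set \<Rightarrow> bool" where
  "tournament n T A \<longleftrightarrow> (\<forall>p. 1 \<le> p \<longrightarrow> p < n \<longrightarrow> p \<notin> A \<longrightarrow> T p = winner T p)"

text \<open>The path from \<open>p\<close> upwards, including \<open>p\<close>. It always reaches
  \<open>0\<close>, which lies outside the tree, so a repair that has arrived at \<open>0\<close>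
  leaves a complete tournament.\<close>

definition ancestors :: "nat \<Rightarrow> nat set" where
  "ancestors p = {p div 2 ^ j | j. True}"

lemma ancestors_rec: "ancestors p = insert p (ancestors (p div 2))"
proof -
  have "p div 2 ^ j = p \<or> (\<exists>i. p div 2 ^ j = p div 2 div 2 ^ i)" for j
    by (cases j) (auto simp: div_mult2_eq)
  moreover have "\<exists>j. p div 2 div 2 ^ i = p div 2 ^ j" for i
    by (rule exI[of _ "Suc i"]) (simp add: div_mult2_eq)
  moreover have "\<exists>j. p = p div 2 ^ j" by (rule exI[of _ 0]) simp
  ultimately show ?thesis unfolding ancestors_def by blast
qed

lemma ancestors_0: "ancestors 0 = {0}"
  by (auto simp: ancestors_def)

lemma tournament_root_leaf:
  assumes "tournament n T {}" "1 \<le> p" "p < 2 * n"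
  shows "\<exists>i<n. T p = T (n + i)"
  using assms(2,3)
\<comment> \<open>Children have larger numbers, so the measure decreases towards the leaves; for
  \<open>p < n\<close> both children lie below \<open>2 * n\<close>, whatever \<open>n\<close>
  is.\<close>
proof (induction "2 * n - p" arbitrary: p rule: less_induct)
  case less
  show ?case
  proof (cases "p < n")
    case True
    then have "T p = T (2 * p) \<or> T p = T (2 * p + 1)"
      using assms(1) less.prems by (auto simp: tournament_def winner_def)
    then show ?thesis
      using less.hyps[of "2 * p"] less.hyps[of "2 * p + 1"] less.prems True by fastforce
  next
    case False
    then show ?thesis using less.prems by (intro exI[of _ "p - n"]) auto
  qed
qed

lemma tournament_root_max:
  assumes "tournament n T {}" "1 \<le> p" "p < 2 * n"
  shows "key (T p) \<le> key (T 1)"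
  using assms(2,3)
proof (induction p rule: less_induct)
  case (less p)
  show ?case
  proof (cases "p = 1")
    case False
    let ?q = "p div 2"
    have q: "1 \<le> ?q" "?q < n" "?q < p" "p = 2 * ?q \<or> p = 2 * ?q + 1" using less.prems False by auto
    then have "T ?q = winner T ?q" using assms(1) by (simp add: tournament_def)
    then have "key (T p) \<le> key (T ?q)" using q(4) by (auto simp: winner_def split: if_splits)
    then show ?thesis using less.IH[of ?q] q less.prems by simp
  qed simp
qed

text \<open>Recomputing \<open>p\<close> establishes its own equation and can break only that of its
  parent \<open>p div 2\<close>, the first of the nodes that remain exempt. Node \<open>0\<close>
  would be its own child, hence \<open>1 \<le> p\<close>.\<close>

lemma tournament_repair:
  assumes "tournament n T (ancestors p)" "1 \<le> p"
  shows "tournament n (T(p := winner T p)) (ancestors (p div 2))"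
  unfolding tournament_def
proof (intro allI impI)
  fix r assume r: "1 \<le> r" "r < n" "r \<notin> ancestors (p div 2)"
  have "p div 2 \<in> ancestors (p div 2)" using ancestors_rec[of "p div 2"] by simp
  then have np: "2 * r \<noteq> p" "2 * r + 1 \<noteq> p" using r(3) by auto
  show "(T(p := winner T p)) r = winner (T(p := winner T p)) r"
  proof (cases "r = p")
    case True
    then show ?thesis using assms(2) by (simp add: winner_def)
  next
    case False
    then have "r \<notin> ancestors p" using r(3) ancestors_rec[of p] by simp
    then have "T r = winner T r" using assms(1) r by (simp add: tournament_def)
    then show ?thesis using np False by (simp add: winner_def)
  qed
qed

lemma tournament_leaf_update:
  assumes "tournament n T {}" "n \<le> p"
  shows "tournament n (T(p := v)) (ancestors (p div 2))"
  unfolding tournament_def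
proof (intro allI impI)
  fix r assume r: "1 \<le> r" "r < n" "r \<notin> ancestors (p div 2)"
  have "p div 2 \<in> ancestors (p div 2)" using ancestors_rec[of "p div 2"] by simp
  then have np: "2 * r \<noteq> p" "2 * r + 1 \<noteq> p" using r(3) by auto
  have "T r = winner T r" using assms(1) r by (simp add: tournament_def)
  then show "(T(p := v)) r = winner (T(p := v)) r"
    using np r assms(2) by (simp add: winner_def)
qed

lemma tournament_build:
  assumes "tournament n T {..p}" "1 \<le> p"
  shows "tournament n (T(p := winner T p)) {..p - 1}"
  unfolding tournament_def
proof (intro allI impI)
  fix r assume r: "1 \<le> r" "r < n" "r \<notin> {..p - 1}"
  then have np: "p \<le> r" "2 * r \<noteq> p" "2 * r + 1 \<noteq> p" using assms(2) by auto
  show "(T(p := winner T p)) r = winner (T(p := winner T p)) r"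
  proof (cases "r = p")
    case True
    then show ?thesis using assms(2) by (simp add: winner_def)
  next
    case False
    then have "T r = winner T r" using assms(1) r np by (simp add: tournament_def)
    then show ?thesis using np False by (simp add: winner_def)
  qed
qed

lemma tournament_cong:
  assumes "tournament n T A" "\<And>p. 1 \<le> p \<Longrightarrow> p < 2 * n \<Longrightarrow> T' p = T p"
  shows "tournament n T' A"
  using assms by (auto simp: tournament_def winner_def)

section \<open>The machine program\<close>

text \<open>Cells below \<open>20\<close> are registers: \<open>0\<close> holds \<open>n\<close>, \<open>3\<close> a loop counter or tree node, \<open>4\<close> holds \<open>3 * n\<close>,
  \<open>8\<close> the starting time of the exploration built so far, \<open>15\<close> the address just below it, \<open>16\<close> its number
  of time edges, and \<open>5\<close>, \<open>9\<close>, \<open>10\<close>, \<open>14\<close> the constants \<open>1\<close>, \<open>0\<close>, \<open>20\<close>, \<open>3\<close>. Tree node \<open>p\<close> occupies the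
  three cells from \<open>20 + 3 * p\<close> on (leaf, first label, second label), so the input shifted by
  \<open>20 + 3 * n\<close> is the bottom layer of the tree and the root lies in the cells \<open>23\<close>, \<open>24\<close>, \<open>25\<close>. The
  exploration is written above the tree, growing downwards from cell \<open>20 + 12 * n\<close>.\<close>
definition node :: "(nat \<Rightarrow> int) \<Rightarrow> nat \<Rightarrow> int \<times> int \<times> int" where
  "node m p = (m (20 + 3 * p), m (21 + 3 * p), m (22 + 3 * p))"

definition regs :: "nat \<Rightarrow> (nat \<Rightarrow> int) \<Rightarrow> bool" where
  "regs n m \<longleftrightarrow> m 0 = int n \<and> m 5 = 1 \<and> m 9 = 0 \<and> m 10 = 20 \<and> m 14 = 3"

text \<open>Register \<open>3\<close> holds the node \<open>p\<close>. Registers \<open>6\<close>,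
  \<open>7\<close>, \<open>13\<close> point to the nodes \<open>p\<close>, \<open>2 * p\<close>,
  \<open>2 * p + 1\<close>, and \<open>12\<close> and \<open>11\<close> hold the keys of the two
  children; \<open>7\<close> is redirected if the right child wins.\<close>

definition fixup :: com where
  "fixup = Seq (Blk [Add 6 3 3, Add 6 6 3, Add 7 6 6, Add 6 6 10, Add 7 7 10, Add 11 7 5,
       Load 12 11, Add 13 7 14, Add 11 13 5, Load 11 11])
     (Seq (Cond 12 11 (Blk [Add 7 13 9]) (Blk []))
     (Blk [Load 11 7, Store 6 11, Add 7 7 5, Add 6 6 5, Load 11 7, Store 6 11, Add 7 7 5,
       Add 6 6 5, Load 11 7, Store 6 11]))"

lemmas nat_linear = nat_add_distrib nat_mult_distrib

lemma node_eqI: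
  assumes "\<And>a. a \<ge> 20 \<Longrightarrow> m' a = (if a = 20 + 3 * p then v0 else if a = 21 + 3 * p then v1
      else if a = 22 + 3 * p then v2 else m a)"
  shows "node m' = (node m)(p := (v0, v1, v2))"
proof
  fix r
  have "3 * r \<noteq> Suc (3 * p)" "3 * r \<noteq> Suc (Suc (3 * p))" "Suc (3 * r) \<noteq> 3 * p"
    "Suc (Suc (3 * r)) \<noteq> 3 * p" "Suc (3 * r) \<noteq> Suc (Suc (3 * p))" by presburger+
  then show "node m' r = ((node m)(p := (v0, v1, v2))) r"
    by (auto simp: node_def assms)
qed

lemma ensures_fixup:
  assumes r: "regs n m" and p: "m 3 = int p" "1 \<le> p" "p < n"
  shows "ensures fixup m 23 (\<lambda>m'. regs n m' \<and> m' 3 = int p \<and> (\<forall>r\<in>{4,8,15,16}. m' r = m r) \<and>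
    node m' = (node m)(p := winner (node m) p) \<and> (\<forall>a\<ge>20 + 3 * n. m' a = m a))"
proof -
  have rs: "m 0 = int n" "m 5 = 1" "m 9 = 0" "m 10 = 20" "m 14 = 3" using r by (auto simp: regs_def)
  let ?R1 = "\<lambda>m1. m1 6 = int (20 + 3 * p) \<and> m1 7 = int (20 + 6 * p) \<and> m1 13 = int (23 + 6 * p) \<and>
     m1 12 = m (21 + 6 * p) \<and> m1 11 = m (24 + 6 * p) \<and> (\<forall>a. a \<notin> {6,7,11,12,13} \<longrightarrow> m1 a = m a)"
  let ?w = "if m (21 + 6 * p) < m (24 + 6 * p) then 23 + 6 * p else 20 + 6 * p"
  let ?R2 = "\<lambda>m2. m2 6 = int (20 + 3 * p) \<and> m2 7 = int ?w \<and> (\<forall>a. a \<notin> {6,7,11,12,13} \<longrightarrow> m2 a = m a)"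
  have w: "winner (node m) p = (m ?w, m (Suc ?w), m (Suc (Suc ?w)))"
    by (simp add: winner_def node_def key_def algebra_simps eval_nat_numeral)
  \<comment> \<open>As \<open>p\<close> is at least \<open>1\<close>, the three source cells lie
    strictly above the three target cells, so the copy never overwrites what it still has to
    read.\<close>
  have wp: "22 + 3 * p < ?w" using p by simp
  show ?thesis unfolding fixup_def
  proof (rule ensures_Seq[where T = 10 and U = 13])
    show "ensures (Blk [Add 6 3 3, Add 6 6 3, Add 7 6 6, Add 6 6 10, Add 7 7 10, Add 11 7 5,
       Load 12 11, Add 13 7 14, Add 11 13 5, Load 11 11]) m 10 ?R1"
      by (rule ensures_Blk) (auto simp: rs p nat_linear)
  next
    fix m1 assume m1: "?R1 m1"
    show "ensures (Seq (Cond 12 11 (Blk [Add 7 13 9]) (Blk []))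
     (Blk [Load 11 7, Store 6 11, Add 7 7 5, Add 6 6 5, Load 11 7, Store 6 11, Add 7 7 5,
       Add 6 6 5, Load 11 7, Store 6 11])) m1 13 (\<lambda>m'. regs n m' \<and> m' 3 = int p \<and> (\<forall>r\<in>{4,8,15,16}. m' r = m r) \<and>
    node m' = (node m)(p := winner (node m) p) \<and> (\<forall>a\<ge>20 + 3 * n. m' a = m a))"
    proof (rule ensures_Seq[where T = 3 and U = 10])
      show "ensures (Cond 12 11 (Blk [Add 7 13 9]) (Blk [])) m1 3 ?R2"
        by (rule ensures_Cond[where T = 1]; (rule ensures_Blk)?) (use m1 rs in auto)
    next
      fix m2 assume m2: "?R2 m2"
      obtain w where w': "w = ?w" by blast
      define m3 where "m3 = effect [Load 11 7, Store 6 11, Add 7 7 5, Add 6 6 5, Load 11 7, Store 6 11,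
        Add 7 7 5, Add 6 6 5, Load 11 7, Store 6 11] m2"
      have m2': "m2 6 = int (20 + 3 * p)" "m2 7 = int w" "m2 5 = 1"
        "\<And>a. a \<notin> {6,7,11,12,13} \<Longrightarrow> m2 a = m a" using m2 rs w' by auto
      have wp': "22 + 3 * p < w" using wp w' by simp
      have m3: "m3 a = (if a = 20 + 3 * p then m w else if a = 21 + 3 * p then m (Suc w)
        else if a = 22 + 3 * p then m (Suc (Suc w)) else m a)" if "a \<notin> {6,7,11,12,13}" for a
      proof -
        have ne: "w \<notin> {6, 7, 11}" "Suc w \<notin> {6, 7, 11}" "Suc (Suc w) \<notin> {6, 7, 11}"
          "\<And>d. d \<le> 2 \<Longrightarrow> w \<noteq> 20 + 3 * p + d \<and> Suc w \<noteq> 20 + 3 * p + d \<and> Suc (Suc w) \<noteq> 20 + 3 * p + d"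
          using wp' by auto
        have m3': "m3 = m2(11 := m2 (Suc (Suc w)), 7 := int w + 2, 6 := int (22 + 3 * p), 20 + 3 * p := m2 w,
            21 + 3 * p := m2 (Suc w), 22 + 3 * p := m2 (Suc (Suc w)))"
          using ne(1-3) ne(4)[of 0] ne(4)[of 1] ne(4)[of 2]
          by (simp add: m3_def m2'(1-3) nat_linear fun_eq_iff)
        show ?thesis using that wp' m2'(4) unfolding m3' by simp
      qed
      have "node m3 = (node m)(p := winner (node m) p)"
        unfolding w w'[symmetric] using m3 by (intro node_eqI) auto
      moreover have "\<forall>a\<ge>20 + 3 * n. m3 a = m a" using m3 p by auto
      moreover have "regs n m3" using m3 rs by (simp add: regs_def)
      moreover have "m3 3 = int p" "\<forall>r\<in>{4,8,15,16}. m3 r = m r" using m3 p by auto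
      ultimately show "ensures (Blk [Load 11 7, Store 6 11, Add 7 7 5, Add 6 6 5, Load 11 7, Store 6 11, Add 7 7 5,
       Add 6 6 5, Load 11 7, Store 6 11]) m2 10 (\<lambda>m'. regs n m' \<and> m' 3 = int p \<and> (\<forall>r\<in>{4,8,15,16}. m' r = m r) \<and>
         node m' = (node m)(p := winner (node m) p) \<and> (\<forall>a\<ge>20 + 3 * n. m' a = m a))"
        by (intro ensures_Blk_eq[OF m3_def]) simp_all
    qed simp
  qed simp
qed

definition leaves :: "nat \<Rightarrow> (nat \<Rightarrow> nat set) \<Rightarrow> nat set \<Rightarrow> (nat \<Rightarrow> int) \<Rightarrow> bool" where
  "leaves n L D m \<longleftrightarrow> (\<forall>i<n. node m (n + i) =
     (int i, if i \<in> D then 0 else int (fstlab n L i), int (sndlab n L i)))"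

text \<open>This is the output format shifted by \<open>q\<close>; cell \<open>q\<close> itself
  stays free for the number of time edges.\<close>

definition stack :: "(nat \<Rightarrow> int) \<Rightarrow> nat \<Rightarrow> time_edge list \<Rightarrow> bool" where
  "stack m q J \<longleftrightarrow> (\<forall>j<length J. m (q + 3 * j + 1) = int (te_src (J ! j)) \<and>
     m (q + 3 * j + 2) = int (te_dst (J ! j)) \<and> m (q + 3 * j + 3) = int (te_lab (J ! j)))"

text \<open>Cells \<open>3..19\<close> carry input and output but also serve as registers. They are moved by
  unrolled code that only needs the cells \<open>1\<close> and \<open>2\<close>.\<close>
definition save :: "nat list \<Rightarrow> instr list" where
  "save xs = concat (map (\<lambda>a. [Const 1 (int a), Add 1 1 2, Store 1 a]) xs)"

definition restore :: "nat list \<Rightarrow> instr list" where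
  "restore xs = concat (map (\<lambda>a. [Const 1 (int a), Add 1 1 2, Load a 1]) xs)"

lemma save_simps: "list_all basic (save xs)" "length (save xs) = 3 * length xs"
  by (induction xs) (auto simp: save_def)

lemma restore_simps: "list_all basic (restore xs)" "length (restore xs) = 3 * length xs"
  by (induction xs) (auto simp: restore_def)

text \<open>By \<open>20 \<le> b\<close> the targets avoid the cells \<open>3..<20\<close> that are
  still to be saved. Cell \<open>2\<close> keeps the offset, and cell \<open>1\<close> is excluded
  because it holds the address in use.\<close>

lemma effect_save:
  assumes "m 2 = int b" "20 \<le> b" "set xs \<subseteq> {3..<20}" "c \<noteq> 1"
  shows "effect (save xs) m c = (if b \<le> c \<and> c - b \<in> set xs then m (c - b) else m c)"
  using assms
proof (induction xs arbitrary: m)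
  case (Cons a xs)
  let ?m = "effect [Const 1 (int a), Add 1 1 2, Store 1 a] m"
  have m: "?m = m(1 := int (a + b), a + b := m a)"
    using Cons.prems by (auto simp: nat_linear)
  have "effect (save (a # xs)) m c = effect (save xs) ?m c" by (simp add: save_def)
  also have "\<dots> = (if b \<le> c \<and> c - b \<in> set xs then ?m (c - b) else ?m c)"
    using Cons.prems by (intro Cons.IH) (auto simp: m)
  finally show ?case using Cons.prems unfolding m by auto
qed (simp add: save_def)

lemma effect_restore:
  assumes "m 2 = int b" "20 \<le> b" "set xs \<subseteq> {3..<20}" "c \<noteq> 1"
  shows "effect (restore xs) m c = (if c \<in> set xs then m (b + c) else m c)"
  using assms
proof (induction xs arbitrary: m)
  case (Cons a xs)
  let ?m = "effect [Const 1 (int a), Add 1 1 2, Load a 1] m"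
  have m: "?m = m(1 := int (a + b), a := m (b + a))"
    using Cons.prems by (auto simp: nat_linear add.commute)
  have "effect (restore (a # xs)) m c = effect (restore xs) ?m c" by (simp add: restore_def)
  also have "\<dots> = (if c \<in> set xs then ?m (b + c) else ?m c)"
    using Cons.prems by (intro Cons.IH) (auto simp: m)
  finally show ?case using Cons.prems unfolding m by auto
qed (simp add: restore_def)

section \<open>Moving the input to the bottom layer of the tree\<close>

definition copy_in :: com where
  "copy_in = Seq (Blk ([Const 1 20, Add 2 0 0, Add 2 2 0, Add 2 2 1] @ save [3..<20] @
       [Const 3 20, Add 4 0 0, Add 4 4 0, Const 5 1]))
     (Loop 3 4 (Blk [Add 6 3 2, Load 7 3, Store 6 7, Add 3 3 5]))"

definition copied :: "nat \<Rightarrow> (nat \<Rightarrow> nat set) \<Rightarrow> (nat \<Rightarrow> int) \<Rightarrow> bool" where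
  "copied n L m \<longleftrightarrow> m 0 = int n \<and> m 2 = int (20 + 3 * n) \<and> m 4 = int (3 * n) \<and> m 5 = 1 \<and>
     (\<forall>c. 1 \<le> c \<longrightarrow> c < 3 * n \<longrightarrow> m (20 + 3 * n + c) = enc_input n L c)"

lemma enc_input_outside: "3 * n \<le> a \<Longrightarrow> 0 < a \<Longrightarrow> enc_input n L a = 0"
  "0 < a \<Longrightarrow> a < 3 \<Longrightarrow> enc_input n L a = 0"
  by (auto simp: enc_input_def)

text \<open>Cells \<open>1\<close> and \<open>2\<close> are \<open>0\<close> in the input and can be
  used without being saved. The targets lie beyond the input, so no input cell is lost before it is
  copied. The straight-line code takes \<open>4 + 3 * 17 + 4\<close> steps, each further cell
  \<open>6\<close>.\<close>

lemma ensures_copy_in: "ensures copy_in (enc_input n L) (18 * n + 61) (copied n L)"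
proof -
  let ?I = "\<lambda>k m. \<exists>a. k = 3 * n - a \<and> 20 \<le> a \<and> m 3 = int a \<and> m 0 = int n \<and> m 2 = int (20 + 3 * n) \<and>
    m 4 = int (3 * n) \<and> m 5 = 1 \<and> (\<forall>c. 1 \<le> c \<longrightarrow> c < a \<longrightarrow> m (20 + 3 * n + c) = enc_input n L c) \<and>
    (\<forall>c. 20 \<le> c \<longrightarrow> c < 3 * n \<longrightarrow> m c = enc_input n L c)"
  let ?pre = "[Const 1 20, Add 2 0 0, Add 2 2 0, Add 2 2 1]"
  let ?post = "[Const 3 20, Add 4 0 0, Add 4 4 0, Const 5 1]"
  show ?thesis unfolding copy_in_def
  proof (rule ensures_Seq[where T = 59 and U = "18 * n + 2"])
    define m1 where "m1 = effect ?pre (enc_input n L)"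
    have i0: "enc_input n L 0 = int n" by (simp add: enc_input_def)
    have m1: "m1 c = (if c = 1 then 20 else if c = 2 then int (20 + 3 * n) else enc_input n L c)" for c
      by (auto simp: m1_def i0)
    define m2 where "m2 = effect (save [3..<20]) m1"
    have m2: "m2 c = (if 20 + 3 * n \<le> c \<and> c - (20 + 3 * n) \<in> {3..<20} then m1 (c - (20 + 3 * n)) else m1 c)"
      if "c \<noteq> 1" for c
      unfolding m2_def using effect_save[of m1 "20 + 3 * n" "[3..<20]" c] that
      by (simp only: m1 set_upt) simp
    define m3 where "m3 = effect ?post m2"
    have m3: "m3 3 = 20" "m3 4 = int (3 * n)" "m3 5 = 1" "\<And>c. c \<notin> {3,4,5} \<Longrightarrow> m3 c = m2 c"
      by (auto simp: m3_def m2 m1 i0)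
    have eff: "effect (?pre @ save [3..<20] @ ?post) (enc_input n L) = m3"
      unfolding m3_def m2_def m1_def effect_simps(3) ..
    have "m3 (20 + 3 * n + c) = enc_input n L c" if "1 \<le> c" "c < 20" for c
      using that by (cases "c < 3") (auto simp: m3 m2 m1 enc_input_outside)
    moreover have "m3 c = enc_input n L c" if "20 \<le> c" "c < 3 * n" for c
      using that by (simp add: m3 m2 m1)
    ultimately have "?I (3 * n - 20) m3"
      by (intro exI[of _ 20]) (simp add: m3 m2 m1 i0)
    then show "ensures (Blk (?pre @ save [3..<20] @ ?post)) (enc_input n L) 59 (?I (3 * n - 20))"
      by (intro ensures_Blk) (simp_all only: eff list_all_append save_simps length_append, simp_all)
  next
    fix m assume m: "?I (3 * n - 20) m"
    show "ensures (Loop 3 4 (Blk [Add 6 3 2, Load 7 3, Store 6 7, Add 3 3 5])) m (18 * n + 2) (copied n L)"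
    proof (rule ensures_Loop[where I = ?I and T = 4])
      show "?I (3 * n - 20) m" by (rule m)
    next
      fix k m assume I: "?I k m" and lt: "m 3 < m 4"
      obtain a where a: "k = 3 * n - a" "20 \<le> a" "m 3 = int a" "m 0 = int n" "m 2 = int (20 + 3 * n)"
        "m 4 = int (3 * n)" "m 5 = 1" "\<And>c. 1 \<le> c \<Longrightarrow> c < a \<Longrightarrow> m (20 + 3 * n + c) = enc_input n L c"
        "\<And>c. 20 \<le> c \<Longrightarrow> c < 3 * n \<Longrightarrow> m c = enc_input n L c"
        using I by blast
      have an: "a < 3 * n" using lt a by simp
      have "?I (k - 1) (effect [Add 6 3 2, Load 7 3, Store 6 7, Add 3 3 5] m)"
        using a(1,2) an
        by (intro exI[of _ "Suc a"]) (auto simp: a(3-7) nat_linear less_Suc_eq a(8,9))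
      then show "0 < k \<and> ensures (Blk [Add 6 3 2, Load 7 3, Store 6 7, Add 3 3 5]) m 4 (?I (k - 1))"
        using a(1) an by (auto intro!: ensures_Blk)
    next
      fix k m assume "?I k m" "\<not> m 3 < m 4"
      then show "copied n L m" unfolding copied_def by auto
    qed simp
  qed simp
qed

text \<open>Register \<open>8\<close> accumulates one plus the sum of all second labels, which
  strictly exceeds each of them; this is the \<open>X\<close> standing for the starting time of the
  empty exploration. The cell with the number of labels is reused for the index of the leaf.\<close>

definition label_leaves :: com where
  "label_leaves = Seq (Blk [Const 9 0, Const 10 20, Const 14 3, Const 3 0, Add 6 2 9, Const 8 1])
     (Loop 3 0 (Blk [Store 6 3, Add 6 6 5, Add 6 6 5, Load 7 6, Add 8 8 7, Add 6 6 5, Add 3 3 5]))"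

definition bounded_by :: "nat \<Rightarrow> (nat \<Rightarrow> nat set) \<Rightarrow> nat \<Rightarrow> bool" where
  "bounded_by n L X \<longleftrightarrow> (\<forall>i<n. sndlab n L i < X)"

lemma ensures_label_leaves:
  assumes "copied n L m"
  shows "ensures label_leaves m (9 * n + 8) (\<lambda>m. regs n m \<and> m 4 = int (3 * n) \<and> leaves n L {} m \<and>
    (\<exists>X. m 8 = int X \<and> bounded_by n L X))"
proof -
  have c: "m 0 = int n" "m 2 = int (20 + 3 * n)" "m 4 = int (3 * n)" "m 5 = 1"
    "\<And>c. 1 \<le> c \<Longrightarrow> c < 3 * n \<Longrightarrow> m (20 + 3 * n + c) = enc_input n L c"
    using assms by (auto simp: copied_def)
  have lab: "m (21 + 3 * (n + j)) = int (fstlab n L j)" "m (22 + 3 * (n + j)) = int (sndlab n L j)"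
    if "j < n" for j
    using that c(5)[of "3 * j + 1"] c(5)[of "3 * j + 2"] enc_input_labels[of n L j]
    by (simp_all add: algebra_simps)
  let ?I = "\<lambda>k m. \<exists>i X. k = n - i \<and> i \<le> n \<and> regs n m \<and> m 4 = int (3 * n) \<and> m 3 = int i \<and>
    m 6 = int (20 + 3 * (n + i)) \<and> m 8 = int X \<and> 0 < X \<and>
    (\<forall>j<i. sndlab n L j < X \<and> m (20 + 3 * (n + j)) = int j) \<and>
    (\<forall>j<n. m (21 + 3 * (n + j)) = int (fstlab n L j) \<and> m (22 + 3 * (n + j)) = int (sndlab n L j))"
  let ?B = "[Store 6 3, Add 6 6 5, Add 6 6 5, Load 7 6, Add 8 8 7, Add 6 6 5, Add 3 3 5]"
  show ?thesis unfolding label_leaves_def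
  proof (rule ensures_Seq[where T = 6 and U = "9 * n + 2"])
    show "ensures (Blk [Const 9 0, Const 10 20, Const 14 3, Const 3 0, Add 6 2 9, Const 8 1]) m 6 (?I n)"
    proof (rule ensures_Blk)
      show "?I n (effect [Const 9 0, Const 10 20, Const 14 3, Const 3 0, Add 6 2 9, Const 8 1] m)"
        by (rule exI[of _ 0], rule exI[of _ 1]) (auto simp: regs_def c(1-4) lab[simplified])
    qed auto
  next
    fix m assume m: "?I n m"
    show "ensures (Loop 3 0 (Blk ?B)) m (9 * n + 2) (\<lambda>m. regs n m \<and> m 4 = int (3 * n) \<and>
      leaves n L {} m \<and> (\<exists>X. m 8 = int X \<and> bounded_by n L X))"
    proof (rule ensures_Loop[where I = ?I and T = 7])
      show "?I n m" by (rule m)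
    next
      fix k m assume I: "?I k m" and lt: "m 3 < m 0"
      obtain i X where i: "k = n - i" "i \<le> n" "m 4 = int (3 * n)" "m 3 = int i"
        "m 6 = int (20 + 3 * (n + i))" "m 8 = int X" "0 < X"
        "\<And>j. j < i \<Longrightarrow> sndlab n L j < X" "\<And>j. j < i \<Longrightarrow> m (20 + 3 * (n + j)) = int j"
        "\<And>j. j < n \<Longrightarrow> m (21 + 3 * (n + j)) = int (fstlab n L j)"
        "\<And>j. j < n \<Longrightarrow> m (22 + 3 * (n + j)) = int (sndlab n L j)"
        and r: "regs n m"
        using I by blast
      have rs: "m 0 = int n" "m 5 = 1" "m 9 = 0" "m 10 = 20" "m 14 = 3" using r by (auto simp: regs_def)
      have lt': "i < n" using lt i rs by simp
      define m' where "m' = effect ?B m"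
      have m': "m' 3 = int (Suc i)" "m' 6 = int (23 + 3 * (n + i))" "m' 8 = int (X + sndlab n L i)"
        "m' (20 + 3 * (n + i)) = int i"
        "\<And>a. a \<notin> {3,6,7,8} \<Longrightarrow> a \<noteq> 20 + 3 * (n + i) \<Longrightarrow> m' a = m a"
        using i(11)[OF lt'] by (auto simp: m'_def rs i(4-6) nat_linear algebra_simps)
      have ne: "21 + 3 * (n + j) \<noteq> 20 + 3 * (n + i)" "22 + 3 * (n + j) \<noteq> 20 + 3 * (n + i)" for j
        by presburger+
      have "?I (k - 1) m'"
      proof (rule exI[of _ "Suc i"], rule exI[of _ "X + sndlab n L i"], intro conjI allI impI)
        fix j assume j: "j < Suc i"
        show "sndlab n L j < X + sndlab n L i" using i(7,8) j by (cases "j = i") (auto intro: trans_less_add1)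
        show "m' (20 + 3 * (n + j)) = int j" using i(9) j m' by (cases "j = i") auto
      next
        fix j assume j: "j < n"
        show "m' (21 + 3 * (n + j)) = int (fstlab n L j)" using i(10)[OF j] m'(5)[OF _ ne(1)] by simp
        show "m' (22 + 3 * (n + j)) = int (sndlab n L j)" using i(11)[OF j] m'(5)[OF _ ne(2)] by simp
      qed (use i(1-3,7) lt' rs m' in \<open>auto simp: regs_def\<close>)
      then have "ensures (Blk ?B) m 7 (?I (k - 1))" by (intro ensures_Blk_eq[OF m'_def]) simp_all
      then show "0 < k \<and> ensures (Blk ?B) m 7 (?I (k - 1))" using i(1) lt' by simp
    next
      fix k m assume I: "?I k m" and ge: "\<not> m 3 < m 0"
      obtain i X where i: "i \<le> n" "regs n m" "m 4 = int (3 * n)" "m 3 = int i" "m 8 = int X"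
        and lab: "\<forall>j<i. sndlab n L j < X \<and> m (20 + 3 * (n + j)) = int j"
        "\<forall>j<n. m (21 + 3 * (n + j)) = int (fstlab n L j) \<and> m (22 + 3 * (n + j)) = int (sndlab n L j)"
        using I by blast
      have "i = n" using i(1,2,4) ge by (simp add: regs_def)
      then show "regs n m \<and> m 4 = int (3 * n) \<and> leaves n L {} m \<and> (\<exists>X. m 8 = int X \<and> bounded_by n L X)"
        using i(2,3,5) lab unfolding leaves_def node_def bounded_by_def by simp
    qed simp
  qed simp
qed

section \<open>Building the tree\<close>

definition build :: com where
  "build = Seq (Blk [Sub 3 0 5]) (Loop 9 3 (Seq fixup (Blk [Sub 3 3 5])))"

lemma leaves_fixup:
  assumes "leaves n L D m" "node m' = (node m)(p := v)" "p < n"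
  shows "leaves n L D m'"
  using assms by (simp add: leaves_def)

text \<open>Parents have smaller numbers than their children, so a descending sweep always meets
  finished children; a node costs \<open>23 + 1 + 2\<close> steps.\<close>

lemma ensures_build:
  assumes "regs n m" "leaves n L D m" "1 \<le> n"
  shows "ensures build m (26 * n + 3) (\<lambda>m'. regs n m' \<and> m' 4 = m 4 \<and> m' 8 = m 8 \<and> leaves n L D m' \<and>
    tournament n (node m') {})"
proof -
  let ?I = "\<lambda>k m'. m' 3 = int k \<and> k < n \<and> regs n m' \<and> m' 4 = m 4 \<and> m' 8 = m 8 \<and> leaves n L D m' \<and>
    tournament n (node m') {..k}"
  show ?thesis unfolding build_def
  proof (rule ensures_Seq[where T = 1 and U = "26 * n + 2"])
    have "node (m(3 := v)) = node m" for v by (simp add: node_def fun_eq_iff)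
    moreover have "tournament n (node m) {..n - 1}" by (auto simp: tournament_def)
    ultimately show "ensures (Blk [Sub 3 0 5]) m 1 (?I (n - 1))"
      using assms by (intro ensures_Blk) (auto simp: regs_def leaves_def)
  next
    fix m' assume m': "?I (n - 1) m'"
    show "ensures (Loop 9 3 (Seq fixup (Blk [Sub 3 3 5]))) m' (26 * n + 2) (\<lambda>m'. regs n m' \<and>
      m' 4 = m 4 \<and> m' 8 = m 8 \<and> leaves n L D m' \<and> tournament n (node m') {})"
    proof (rule ensures_Loop[where I = ?I and T = 24])
      show "?I (n - 1) m'" by (rule m')
    next
      fix k m1 assume I: "?I k m1" and lt: "m1 9 < m1 3"
      have k: "1 \<le> k" using I lt by (auto simp: regs_def)
      have "ensures (Seq fixup (Blk [Sub 3 3 5])) m1 24 (?I (k - 1))"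
      proof (rule ensures_Seq[where T = 23 and U = 1])
        show "ensures fixup m1 23 (\<lambda>m'. regs n m' \<and> m' 3 = int k \<and> (\<forall>r\<in>{4,8,15,16}. m' r = m1 r) \<and>
          node m' = (node m1)(k := winner (node m1) k) \<and> (\<forall>a\<ge>20 + 3 * n. m' a = m1 a))"
          using I k by (intro ensures_fixup) auto
      next
        fix m2 assume m2: "regs n m2 \<and> m2 3 = int k \<and> (\<forall>r\<in>{4,8,15,16}. m2 r = m1 r) \<and>
          node m2 = (node m1)(k := winner (node m1) k) \<and> (\<forall>a\<ge>20 + 3 * n. m2 a = m1 a)"
        have n3: "node (m2(3 := v)) = node m2" for v by (simp add: node_def fun_eq_iff)
        have "leaves n L D m2" using leaves_fixup[of n L D m1 m2 k] m2 I by blast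
        moreover have "tournament n (node m2) {..k - 1}" using tournament_build m2 I k by metis
        ultimately show "ensures (Blk [Sub 3 3 5]) m2 1 (?I (k - 1))"
          using m2 I k n3 by (intro ensures_Blk) (auto simp: regs_def leaves_def of_nat_diff)
      qed simp
      then show "0 < k \<and> ensures (Seq fixup (Blk [Sub 3 3 5])) m1 24 (?I (k - 1))" using k by simp
    next
      fix k m1 assume I: "?I k m1" and ge: "\<not> m1 9 < m1 3"
      then have "k = 0" by (auto simp: regs_def)
      then show "regs n m1 \<and> m1 4 = m 4 \<and> m1 8 = m 8 \<and> leaves n L D m1 \<and> tournament n (node m1) {}"
        using I by (auto simp: tournament_def)
    qed simp
  qed simp
qed

section \<open>One round of the greedy algorithm\<close>

definition decide :: com where
  "decide = Cond 9 25 (Cond 25 8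
     (Blk [Const 17 6, Sub 15 15 17, Add 6 15 5, Store 6 9, Add 6 6 5, Store 6 23, Add 6 6 5, Store 6 24,
       Add 6 6 5, Store 6 23, Add 6 6 5, Store 6 9, Add 6 6 5, Store 6 25, Add 8 24 9,
       Add 16 16 5, Add 16 16 5])
     (Blk [])) (Blk [])"

text \<open>The tree ends below \<open>20 + 6 * n\<close>, and at most \<open>n\<close> visits of
  two time edges with three cells each take \<open>6 * n\<close> cells more: hence
  \<open>20 + 12 * n\<close>.\<close>

definition state :: "nat \<Rightarrow> (nat \<Rightarrow> nat set) \<Rightarrow> nat \<Rightarrow> nat set \<Rightarrow> (nat \<Rightarrow> int) \<Rightarrow> bool" where
  "state n L X D m \<longleftrightarrow> (\<exists>J x q. greedy n L X D J x \<and> m 8 = int x \<and> m 16 = int (length J) \<and>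
     m 15 = int q \<and> q + 3 * length J = 20 + 12 * n \<and> stack m q J)"

lemma greedy_length:
  assumes "greedy n L X D J x"
  shows "length J \<le> 2 * n"
proof -
  have "card (visited J) \<le> card {..<n}"
    using greedyD(1,3)[OF assms] by (intro card_mono) auto
  then show ?thesis using greedyD(4)[OF assms] by simp
qed

text \<open>As long as some leaf is unprocessed, there is room for another visit between the tree
  and the stack.\<close>

lemma greedy_length_less:
  assumes "greedy n L X D J x" "j < n" "j \<notin> D"
  shows "length J + 2 \<le> 2 * n"
proof -
  have "card (visited J) \<le> card ({..<n} - {j})"
    using greedyD(1,3)[OF assms(1)] assms(3) by (intro card_mono) auto
  then show ?thesis using greedyD(4)[OF assms(1)] assms(2) by simp
qed

text \<open>The stack lies entirely above the tree, so steps that change only the tree preserve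
  it.\<close>

lemma state_cong:
  assumes "state n L X D m" "\<forall>r\<in>{8,15,16}. m' r = m r" "\<forall>a\<ge>20 + 6 * n. m' a = m a"
  shows "state n L X D m'"
proof -
  obtain J x q where s: "greedy n L X D J x" "m 8 = int x" "m 16 = int (length J)"
     "m 15 = int q" "q + 3 * length J = 20 + 12 * n" "stack m q J"
    using assms(1) unfolding state_def by blast
  have "20 + 6 * n \<le> q" using s(5) greedy_length[OF s(1)] by simp
  then have "stack m' q J" using s(6) assms(3) by (simp add: stack_def)
  then show ?thesis unfolding state_def using s assms(2) by auto
qed

lemma stack_push:
  assumes "stack m (q + 6) J" "\<And>a. q + 6 < a \<Longrightarrow> m' a = m a"
    and "m' (q + 1) = 0" "m' (q + 2) = int i" "m' (q + 3) = int s"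
    "m' (q + 4) = int i" "m' (q + 5) = 0" "m' (q + 6) = int e"
  shows "stack m' q ((0, i, s) # (i, 0, e) # J)"
  unfolding stack_def
proof (intro allI impI)
  fix j assume j: "j < length ((0, i, s) # (i, 0, e) # J)"
  let ?J = "(0, i, s) # (i, 0, e) # J"
  consider "j = 0" | "j = 1" | k where "j = Suc (Suc k)" by (metis One_nat_def not0_implies_Suc)
  then show "m' (q + 3 * j + 1) = int (te_src (?J ! j)) \<and> m' (q + 3 * j + 2) = int (te_dst (?J ! j)) \<and>
      m' (q + 3 * j + 3) = int (te_lab (?J ! j))"
  proof cases
    case 1
    then show ?thesis using assms(3-5) by (simp add: te_src_def te_dst_def te_lab_def)
  next
    case 2
    then show ?thesis using assms(6-8) by (simp add: te_src_def te_dst_def te_lab_def add.commute)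
  next
    case 3
    then have "k < length J" using j by simp
    then have "m (q + 6 + 3 * k + 1) = int (te_src (J ! k))" "m (q + 6 + 3 * k + 2) = int (te_dst (J ! k))"
      "m (q + 6 + 3 * k + 3) = int (te_lab (J ! k))" using assms(1) by (simp_all add: stack_def)
    moreover have "q + 3 * j + 1 = q + 6 + 3 * k + 1" "q + 3 * j + 2 = q + 6 + 3 * k + 2"
      "q + 3 * j + 3 = q + 6 + 3 * k + 3" "?J ! j = J ! k" using 3 by simp_all
    ultimately show ?thesis
      using assms(2)[of "q + 6 + 3 * k + 1"] assms(2)[of "q + 6 + 3 * k + 2"]
        assms(2)[of "q + 6 + 3 * k + 3"] by simp
  qed
qed

text \<open>The root supplies leaf, start and end in the cells \<open>23\<close>, \<open>24\<close>,
  \<open>25\<close>. The two tests are the hypotheses of \<open>greedy_accept\<close>: a second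
  label exists, and it lies before the starting time in register \<open>8\<close>. A visit is pushed
  as six cells below the stack.\<close>

lemma ensures_decide:
  assumes star: "temporal_star_k n L 2" and X: "bounded_by n L X"
    and r: "regs n m" and st: "state n L X D m"
    and root: "m 23 = int j" "m 24 = int (fstlab n L j)" "m 25 = int (sndlab n L j)"
    and j: "j < n" "j \<notin> D" "\<forall>i<n. i \<notin> D \<longrightarrow> fstlab n L i \<le> fstlab n L j"
  shows "ensures decide m 21 (\<lambda>m'. regs n m' \<and> state n L X (insert j D) m' \<and>
    (\<forall>a. 20 \<le> a \<longrightarrow> a < 20 + 6 * n \<longrightarrow> m' a = m a))" (is "ensures _ _ _ ?Q")
proof -
  obtain J x q0 where s: "greedy n L X D J x" "m 8 = int x" "m 16 = int (length J)"
     "m 15 = int q0" "q0 + 3 * length J = 20 + 12 * n" "stack m q0 J"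
    using st unfolding state_def by blast
  have rs: "m 0 = int n" "m 5 = 1" "m 9 = 0" "m 10 = 20" "m 14 = 3" using r by (auto simp: regs_def)
  have X': "\<forall>i<n. sndlab n L i < X" using X by (simp add: bounded_by_def)
  have reject: "?Q m" if "\<not> (0 < sndlab n L j \<and> sndlab n L j < x)"
    using greedy_reject[OF star s(1) j X' that] r s(2-6) unfolding state_def by blast
  have accept: "ensures (Blk [Const 17 6, Sub 15 15 17, Add 6 15 5, Store 6 9, Add 6 6 5, Store 6 23,
      Add 6 6 5, Store 6 24, Add 6 6 5, Store 6 23, Add 6 6 5, Store 6 9, Add 6 6 5, Store 6 25, Add 8 24 9,
      Add 16 16 5, Add 16 16 5]) m 17 ?Q" (is "ensures (Blk ?B) m 17 ?Q")
    if yes: "0 < sndlab n L j" "sndlab n L j < x"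
  proof -
    have "26 + 6 * n \<le> q0" using s(5) greedy_length_less[OF s(1) j(1,2)] by simp
    then have "q0 = (q0 - 6) + 6" "20 + 6 * n \<le> q0 - 6" by simp_all
    then obtain q where q: "q0 = q + 6" "20 + 6 * n \<le> q" by blast
    have q25: "25 < q" using q(2) j(1) by simp
    define m' where "m' = effect ?B m"
    have m': "m' = m(17 := 6, 15 := int q, q + 1 := 0, q + 2 := int j, q + 3 := int (fstlab n L j),
        q + 4 := int j, q + 5 := 0, q + 6 := int (sndlab n L j), 6 := int (q + 6),
        8 := int (fstlab n L j), 16 := int (length J + 2))"
      using q25 by (simp add: m'_def rs s(2-4) root q(1) nat_linear fun_eq_iff)
    let ?J = "(0, j, fstlab n L j) # (j, 0, sndlab n L j) # J"
    have "stack m' q ?J"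
      by (rule stack_push[of m]) (use s(6) q25 in \<open>simp_all add: m' q(1)\<close>)
    moreover have "greedy n L X (insert j D) ?J (fstlab n L j)"
      using greedy_accept[OF star s(1) j X' yes] .
    moreover have "m' 8 = int (fstlab n L j)" "m' 16 = int (length ?J)" "m' 15 = int q"
      "q + 3 * length ?J = 20 + 12 * n"
      using q25 s(5) q(1) by (simp_all add: m')
    ultimately have "state n L X (insert j D) m'" unfolding state_def by blast
    moreover have "regs n m'" using q25 by (simp add: regs_def m' rs)
    moreover have "\<forall>a. 20 \<le> a \<longrightarrow> a < 20 + 6 * n \<longrightarrow> m' a = m a" using q(2) by (simp add: m')
    ultimately show ?thesis by (intro ensures_Blk_eq[OF m'_def]) simp_all
  qed
  show ?thesis unfolding decide_def
  proof (rule ensures_Cond[where T = 19])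
    assume 1: "m 9 < m 25"
    show "ensures (Cond 25 8 (Blk ?B) (Blk [])) m 19 ?Q"
    proof (rule ensures_Cond[where T = 17])
      assume "m 25 < m 8"
      then show "ensures (Blk ?B) m 17 ?Q" using 1 rs root s(2) by (intro accept) auto
    next
      assume "\<not> m 25 < m 8"
      then have "?Q m" using root s(2) by (intro reject) auto
      then show "ensures (Blk []) m 17 ?Q" by (intro ensures_Blk) simp_all
    qed simp
  next
    assume "\<not> m 9 < m 25"
    then have "?Q m" using root rs by (intro reject) auto
    then show "ensures (Blk []) m 19 ?Q" by (intro ensures_Blk) simp_all
  qed simp
qed

definition climb :: com where
  "climb = Loop 9 3 (Seq fixup (Blk [Half 3 3]))"

text \<open>Halving a number below \<open>2 ^ k\<close> reaches \<open>0\<close> in at most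
  \<open>k\<close> rounds of \<open>26\<close> steps.\<close>

lemma ensures_climb:
  assumes "regs n m" "m 3 = int p" "p < 2 ^ k" "p < n" "leaves n L D m" "state n L X D m"
    and "tournament n (node m) (ancestors p)"
  shows "ensures climb m (26 * k + 2) (\<lambda>m. regs n m \<and> leaves n L D m \<and> state n L X D m \<and>
    tournament n (node m) {})"
proof -
  let ?I = "\<lambda>k m. \<exists>p. m 3 = int p \<and> p < 2 ^ k \<and> p < n \<and> regs n m \<and> leaves n L D m \<and> state n L X D m \<and>
    tournament n (node m) (ancestors p)"
  show ?thesis unfolding climb_def
  proof (rule ensures_Loop[where I = ?I and T = 24 and k = k])
    show "?I k m" using assms by blast
  next
    fix k m assume I: "?I k m" and lt: "m 9 < m 3"
    obtain p where p: "m 3 = int p" "p < 2 ^ k" "p < n" "regs n m" "leaves n L D m" "state n L X D m"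
      "tournament n (node m) (ancestors p)"
      using I by blast
    have p1: "1 \<le> p" using lt p(1,4) by (simp add: regs_def)
    have k: "0 < k" using p(2) p1 by (cases k) auto
    have pk: "p div 2 < 2 ^ (k - 1)" using p(2) k by (cases k) auto
    have "ensures (Seq fixup (Blk [Half 3 3])) m 24 (?I (k - 1))"
    proof (rule ensures_Seq[where T = 23 and U = 1])
      show "ensures fixup m 23 (\<lambda>m'. regs n m' \<and> m' 3 = int p \<and> (\<forall>r\<in>{4,8,15,16}. m' r = m r) \<and>
        node m' = (node m)(p := winner (node m) p) \<and> (\<forall>a\<ge>20 + 3 * n. m' a = m a))"
        using p p1 by (intro ensures_fixup) auto
    next
      fix m2 assume m2: "regs n m2 \<and> m2 3 = int p \<and> (\<forall>r\<in>{4,8,15,16}. m2 r = m r) \<and>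
        node m2 = (node m)(p := winner (node m) p) \<and> (\<forall>a\<ge>20 + 3 * n. m2 a = m a)"
      let ?m = "m2(3 := int (p div 2))"
      have n3: "node ?m = node m2" by (simp add: node_def fun_eq_iff)
      have "leaves n L D m2" using leaves_fixup[of n L D m m2 p] m2 p by blast
      then have "leaves n L D ?m" by (simp add: leaves_def n3)
      moreover have "tournament n (node ?m) (ancestors (p div 2))"
        using tournament_repair[OF p(7) p1] m2 n3 by simp
      moreover have "state n L X D ?m"
        using m2 by (intro state_cong[OF p(6)]) auto
      moreover have "regs n ?m" using m2 by (simp add: regs_def)
      ultimately have "?I (k - 1) ?m" using pk p(3) by (intro exI[of _ "p div 2"]) auto
      moreover have "?m = effect [Half 3 3] m2" using m2 by (simp add: zdiv_int)
      ultimately show "ensures (Blk [Half 3 3]) m2 1 (?I (k - 1))"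
        by (intro ensures_Blk_eq[of ?m]) simp_all
    qed simp
    then show "0 < k \<and> ensures (Seq fixup (Blk [Half 3 3])) m 24 (?I (k - 1))" using k by simp
  next
    fix k m assume I: "?I k m" and ge: "\<not> m 9 < m 3"
    obtain p where p: "m 3 = int p" "regs n m" "leaves n L D m" "state n L X D m"
      "tournament n (node m) (ancestors p)"
      using I by blast
    have "p = 0" using p ge by (simp add: regs_def)
    then show "regs n m \<and> leaves n L D m \<and> state n L X D m \<and> tournament n (node m) {}"
      using p by (auto simp: tournament_def ancestors_0)
  qed simp
qed

definition remove_root :: "instr list" where
  "remove_root = [Add 3 0 23, Add 6 3 3, Add 6 6 3, Add 6 6 10, Add 6 6 5, Store 6 9, Half 3 3]"

text \<open>\<open>D\<close> and \<open>D'\<close> may differ because the exploration already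
  accounts for \<open>j\<close> when its key is erased. Register \<open>3\<close> is left at the
  parent of the erased leaf, where the repair starts.\<close>

lemma effect_remove_root:
  assumes "regs n m" "m 23 = int j" "leaves n L D m" "j < n"
    and "tournament n (node m) {}" "state n L X D' m"
  shows "regs n (effect remove_root m)" "effect remove_root m 3 = int ((n + j) div 2)"
    "leaves n L (insert j D) (effect remove_root m)" "state n L X D' (effect remove_root m)"
    "tournament n (node (effect remove_root m)) (ancestors ((n + j) div 2))"
proof -
  let ?m = "effect remove_root m"
  have rs: "m 0 = int n" "m 5 = 1" "m 9 = 0" "m 10 = 20" "m 14 = 3"
    using assms(1) by (auto simp: regs_def)
  have m: "?m = m(6 := int (21 + 3 * (n + j)), 21 + 3 * (n + j) := 0, 3 := int ((n + j) div 2))"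
    by (simp add: remove_root_def rs assms(2) nat_linear fun_eq_iff zdiv_int)
  show "regs n ?m" "?m 3 = int ((n + j) div 2)" unfolding m by (simp_all add: regs_def rs)
  have nd: "node m (n + j) = (int j, if j \<in> D then 0 else int (fstlab n L j), int (sndlab n L j))"
    using assms(3,4) by (simp add: leaves_def)
  then have "m (20 + 3 * (n + j)) = int j" "m (22 + 3 * (n + j)) = int (sndlab n L j)"
    by (simp_all add: node_def)
  then have node: "node ?m = (node m)(n + j := (int j, 0, int (sndlab n L j)))"
    unfolding m by (intro node_eqI) auto
  show "leaves n L (insert j D) ?m" using assms(3) by (auto simp: leaves_def node)
  show "tournament n (node ?m) (ancestors ((n + j) div 2))"
    unfolding node using tournament_leaf_update[OF assms(5)] by simp
  show "state n L X D' ?m"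
    using assms(4) by (intro state_cong[OF assms(6)]) (auto simp: m)
qed

section \<open>Processing all intervals\<close>

definition schedule :: com where
  "schedule = Seq (Blk [Add 15 4 4, Add 15 15 15, Add 15 15 10, Const 16 0])
     (Loop 9 24 (Seq decide (Seq (Blk remove_root) climb)))"

text \<open>Removed leaves have key \<open>0\<close>, so a positive root key belongs to an
  unprocessed leaf and, being maximal, is the latest start among these.\<close>

lemma ensures_schedule_body:
  assumes star: "temporal_star_k n L 2" and X: "bounded_by n L X" and k: "n < 2 ^ k" "1 \<le> n"
    and m: "regs n m" "leaves n L D m" "state n L X D m" "tournament n (node m) {}"
    and pos: "m 9 < m 24"
  shows "\<exists>j<n. j \<notin> D \<and> 0 < fstlab n L j \<and>
    ensures (Seq decide (Seq (Blk remove_root) climb)) m (26 * k + 30)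
      (\<lambda>m. regs n m \<and> leaves n L (insert j D) m \<and> state n L X (insert j D) m \<and> tournament n (node m) {})"
proof -
  have root: "node m 1 = (m 23, m 24, m 25)" by (simp add: node_def)
  obtain j where j: "j < n" "node m 1 = node m (n + j)"
    using tournament_root_leaf[OF m(4), of 1] k(2) by auto
  have leaf: "node m (n + i) = (int i, if i \<in> D then 0 else int (fstlab n L i), int (sndlab n L i))"
    if "i < n" for i using m(2) that by (simp add: leaves_def)
  have p24: "0 < m 24" using pos m(1) by (simp add: regs_def)
  have jD: "j \<notin> D" using p24 root j leaf[of j] by auto
  then have vals: "m 23 = int j" "m 24 = int (fstlab n L j)" "m 25 = int (sndlab n L j)"
    using root j leaf[of j] by auto
  have latest: "\<forall>i<n. i \<notin> D \<longrightarrow> fstlab n L i \<le> fstlab n L j"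
  proof (intro allI impI)
    fix i assume i: "i < n" "i \<notin> D"
    have "key (node m (n + i)) \<le> key (node m 1)"
      using tournament_root_max[OF m(4), of "n + i"] i by simp
    then show "fstlab n L i \<le> fstlab n L j" using leaf[OF i(1)] i root vals by (simp add: key_def)
  qed
  have "ensures (Seq decide (Seq (Blk remove_root) climb)) m (26 * k + 30)
      (\<lambda>m. regs n m \<and> leaves n L (insert j D) m \<and> state n L X (insert j D) m \<and> tournament n (node m) {})"
  proof (rule ensures_Seq[OF ensures_decide[OF star X m(1,3) vals j(1) jD latest], where U = "26 * k + 9"])
    fix m1 assume m1: "regs n m1 \<and> state n L X (insert j D) m1 \<and>
      (\<forall>a. 20 \<le> a \<longrightarrow> a < 20 + 6 * n \<longrightarrow> m1 a = m a)"
    have node: "node m1 p = node m p" if "p < 2 * n" for p using m1 that by (simp add: node_def)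
    have t1: "tournament n (node m1) {}" using tournament_cong[OF m(4)] node by blast
    have l1: "leaves n L D m1" using m(2) node by (simp add: leaves_def)
    have 23: "m1 23 = int j" using m1 vals(1) k(2) by simp
    have st1: "regs n m1" "state n L X (insert j D) m1" using m1 by auto
    let ?m2 = "effect remove_root m1"
    show "ensures (Seq (Blk remove_root) climb) m1 (26 * k + 9) (\<lambda>m. regs n m \<and>
      leaves n L (insert j D) m \<and> state n L X (insert j D) m \<and> tournament n (node m) {})"
    proof (rule ensures_Seq[where T = 7 and R = "\<lambda>m. m = ?m2" and U = "26 * k + 2"])
      show "ensures (Blk remove_root) m1 7 (\<lambda>m. m = ?m2)"
        by (rule ensures_Blk) (simp_all add: remove_root_def)
    next
      note e = effect_remove_root[OF st1(1) 23 l1 j(1) t1 st1(2)]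
      \<comment> \<open>For \<open>n = 1\<close> the only leaf is also the root and this number is
        \<open>0\<close>: the climb is then empty.\<close>
      have "(n + j) div 2 < n" using j(1) by simp
      then have "(n + j) div 2 < n" "(n + j) div 2 < 2 ^ k" using k(1) by linarith+
      fix m2 assume "m2 = ?m2"
      then show "ensures climb m2 (26 * k + 2) (\<lambda>m. regs n m \<and>
        leaves n L (insert j D) m \<and> state n L X (insert j D) m \<and> tournament n (node m) {})"
        using ensures_climb[OF e(1,2) \<open>(n + j) div 2 < 2 ^ k\<close> \<open>(n + j) div 2 < n\<close> e(3,4,5)] by simp
    qed simp
  qed simp
  then show ?thesis using j(1) jD p24 vals(2) by auto
qed

definition finished :: "nat \<Rightarrow> (nat \<Rightarrow> nat set) \<Rightarrow> (nat \<Rightarrow> int) \<Rightarrow> bool" where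
  "finished n L m \<longleftrightarrow> regs n m \<and> (\<exists>J q. max_exploration n L J \<and> m 16 = int (length J) \<and>
     m 15 = int q \<and> q + 3 * length J = 20 + 12 * n \<and> stack m q J \<and> length J \<le> 2 * n)"

text \<open>The loop counter is the number of unprocessed leaves with positive first label, hence at
  most \<open>n\<close>. Once the root key is \<open>0\<close>, its maximality makes the first label
  of every unprocessed leaf \<open>0\<close>, as \<open>greedy_optimal\<close> requires.\<close>

lemma ensures_schedule:
  assumes star: "temporal_star_k n L 2" and X: "bounded_by n L X" and k: "n < 2 ^ k" "1 \<le> n"
    and m: "regs n m" "m 4 = int (3 * n)" "m 8 = int X" "leaves n L {} m" "tournament n (node m) {}"
  shows "ensures schedule m (n * (26 * k + 32) + 6) (finished n L)"
proof -
  let ?rem = "\<lambda>D. {i. i < n \<and> i \<notin> D \<and> 0 < fstlab n L i}"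
  let ?I = "\<lambda>c m. \<exists>D. c = card (?rem D) \<and> regs n m \<and> leaves n L D m \<and> state n L X D m \<and>
    tournament n (node m) {}"
  have rs: "m 0 = int n" "m 5 = 1" "m 9 = 0" "m 10 = 20" "m 14 = 3" using m(1) by (auto simp: regs_def)
  show ?thesis unfolding schedule_def
  proof (rule ensures_Seq[where T = 4 and U = "n * (26 * k + 32) + 2" and R = "?I (card (?rem {}))"])
    let ?m = "m(15 := int (20 + 12 * n), 16 := 0)"
    have node: "node ?m = node m" by (simp add: node_def fun_eq_iff)
    have "greedy n L X {} [] X" by (rule greedy_empty)
    moreover have "stack ?m (20 + 12 * n) []" by (simp add: stack_def)
    moreover have "?m 8 = int X" "?m 16 = int (length [])" "?m 15 = int (20 + 12 * n)"
      "20 + 12 * n + 3 * length [] = 20 + 12 * n" using m by simp_all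
    ultimately have "state n L X {} ?m" unfolding state_def by blast
    moreover have "leaves n L {} ?m" using m(4) unfolding leaves_def node .
    moreover have "regs n ?m" using rs by (simp add: regs_def)
    moreover have "tournament n (node ?m) {}" using m(5) unfolding node .
    ultimately have "?I (card (?rem {})) ?m" by blast
    moreover have "?m = effect [Add 15 4 4, Add 15 15 15, Add 15 15 10, Const 16 0] m"
      by (simp add: rs m(2) fun_eq_iff)
    ultimately show "ensures (Blk [Add 15 4 4, Add 15 15 15, Add 15 15 10, Const 16 0]) m 4
      (?I (card (?rem {})))" by (intro ensures_Blk_eq[of ?m]) simp_all
  next
    fix m assume m: "?I (card (?rem {})) m"
    show "ensures (Loop 9 24 (Seq decide (Seq (Blk remove_root) climb))) m (n * (26 * k + 32) + 2)
      (finished n L)"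
    proof (rule ensures_Loop[where I = ?I and T = "26 * k + 30"])
      show "?I (card (?rem {})) m" by (rule m)
    next
      have "card (?rem {}) \<le> card {..<n}" by (intro card_mono) auto
      then have "card (?rem {}) * (26 * k + 32) \<le> n * (26 * k + 32)" by (intro mult_right_mono) auto
      then show "card (?rem {}) * (26 * k + 30 + 2) + 2 \<le> n * (26 * k + 32) + 2"
        by (simp add: algebra_simps)
    next
      fix c m assume "?I c m" and lt: "m 9 < m 24"
      then obtain D where D: "c = card (?rem D)" "regs n m" "leaves n L D m" "state n L X D m"
        "tournament n (node m) {}" by blast
      obtain j where j: "j < n" "j \<notin> D" "0 < fstlab n L j" and
        e: "ensures (Seq decide (Seq (Blk remove_root) climb)) m (26 * k + 30)
          (\<lambda>m. regs n m \<and> leaves n L (insert j D) m \<and> state n L X (insert j D) m \<and> tournament n (node m) {})"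
        using ensures_schedule_body[OF star X k D(2-5) lt] by blast
      have "?rem (insert j D) = ?rem D - {j}" by auto
      moreover have "j \<in> ?rem D" using j by simp
      moreover have "finite (?rem D)" by simp
      ultimately have c: "c - 1 = card (?rem (insert j D))" "0 < c"
        unfolding D(1) by (simp_all only: card_Diff_singleton card_gt_0_iff) blast
      have "ensures (Seq decide (Seq (Blk remove_root) climb)) m (26 * k + 30) (?I (c - 1))"
        by (rule ensures_mono[OF e order_refl]) (use c(1) in blast)
      then show "0 < c \<and> ensures (Seq decide (Seq (Blk remove_root) climb)) m (26 * k + 30) (?I (c - 1))"
        using c(2) by (rule conjI[rotated])
    next
      fix c m assume "?I c m" and ge: "\<not> m 9 < m 24"
      then obtain D where D: "regs n m" "leaves n L D m" "state n L X D m"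
        "tournament n (node m) {}" by blast
      have "fstlab n L i = 0" if i: "i < n" "i \<notin> D" for i
      proof -
        have "key (node m (n + i)) \<le> key (node m 1)"
          using tournament_root_max[OF D(4), of "n + i"] i by simp
        moreover have "key (node m 1) = m 24" by (simp add: key_def node_def)
        moreover have "key (node m (n + i)) = int (fstlab n L i)"
          using D(2) i by (simp add: key_def leaves_def)
        ultimately show ?thesis using D(1) ge by (simp add: regs_def)
      qed
      then have all: "\<forall>i<n. i \<notin> D \<longrightarrow> fstlab n L i = 0" by blast
      obtain J x q where s: "greedy n L X D J x" "m 16 = int (length J)"
        "m 15 = int q" "q + 3 * length J = 20 + 12 * n" "stack m q J"
        using D(3) unfolding state_def by blast
      show "finished n L m"
        using greedy_optimal[OF star s(1) all] greedy_length[OF s(1)] s(2-5) D(1)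
        unfolding finished_def by blast
    qed
  qed simp
qed

text \<open>In the last block the first output cell, cell \<open>1\<close>, serves as scratch space: the source of the
  first time edge is always \<open>0\<close>.\<close>
definition copy_out :: com where
  "copy_out = Seq (Blk [Store 15 16, Add 2 15 9, Const 3 20])
     (Seq (Loop 3 2 (Blk [Add 6 3 2, Load 7 6, Store 3 7, Add 3 3 5]))
       (Blk (restore [3..<20] @ [Const 1 2, Add 1 1 2, Const 0 0, Add 0 0 2, Load 2 1, Load 0 0, Const 1 0])))"

section \<open>Moving the exploration to the output cells\<close>

lemma decode_stack:
  assumes "stack m q J" "exploration n L J" "3 * length J < q"
    and "m' 0 = int (length J)" "m' 1 = 0" "\<And>c. 2 \<le> c \<Longrightarrow> c < q \<Longrightarrow> m' c = m (q + c)"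
  shows "dec_output m' = J" "out_wellformed m'"
proof -
  have cells: "m' (3 * j + 1) = int (te_src (J ! j))" "m' (3 * j + 2) = int (te_dst (J ! j))"
    "m' (3 * j + 3) = int (te_lab (J ! j))" if j: "j < length J" for j
  proof -
    have s: "m (q + 3 * j + 1) = int (te_src (J ! j))" "m (q + 3 * j + 2) = int (te_dst (J ! j))"
      "m (q + 3 * j + 3) = int (te_lab (J ! j))" using assms(1) j by (simp_all add: stack_def)
    have "3 * j + 3 < q" using j assms(3) by linarith
    then show "m' (3 * j + 2) = int (te_dst (J ! j))" "m' (3 * j + 3) = int (te_lab (J ! j))"
      using s assms(6)[of "3 * j + 2"] assms(6)[of "3 * j + 3"] by (simp_all add: add.assoc)
    show "m' (3 * j + 1) = int (te_src (J ! j))"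
    proof (cases "j = 0")
      case True
      have "te_src (hd J) = 0" using assms(2) j by (auto simp: exploration_def journey_def)
      then show ?thesis using True j assms(5) by (simp add: hd_conv_nth)
    next
      case False
      then show ?thesis using s assms(6)[of "3 * j + 1"] \<open>3 * j + 3 < q\<close> by (simp add: add.assoc)
    qed
  qed
  show "dec_output m' = J"
    unfolding dec_output_def assms(4)
    by (rule nth_equalityI) (simp_all add: cells te_src_def te_dst_def te_lab_def del: add_Suc_right One_nat_def add_2_eq_Suc')
  have "0 \<le> m' a" if "a \<le> 3 * length J" for a
  proof (cases "a = 0")
    case False
    define j where "j = (a - 1) div 3"
    have "a = 3 * j + 1 \<or> a = 3 * j + 2 \<or> a = 3 * j + 3" using False unfolding j_def by presburger
    moreover have "j < length J" using that False unfolding j_def by linarith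
    ultimately show ?thesis using cells[of j] by (auto simp del: add_Suc_right One_nat_def add_2_eq_Suc')
  qed (simp add: assms(4))
  then show "out_wellformed m'" by (simp add: out_wellformed_def assms(4))
qed

lemma ensures_copy_out:
  assumes "finished n L m"
  shows "ensures copy_out m (72 * n + 63) (\<lambda>m. out_wellformed m \<and> max_exploration n L (dec_output m))"
    (is "ensures _ _ _ ?Q")
proof -
  obtain J q where s: "regs n m" "max_exploration n L J" "m 16 = int (length J)"
     "m 15 = int q" "q + 3 * length J = 20 + 12 * n" "stack m q J" "length J \<le> 2 * n"
    using assms unfolding finished_def by blast
  have rs: "m 0 = int n" "m 5 = 1" "m 9 = 0" "m 10 = 20" "m 14 = 3" using s(1) by (auto simp: regs_def)
  have q: "20 + 6 * n \<le> q" using s(5,7) by simp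
  define g where "g = m(q := int (length J))"
  \<comment> \<open>The loop reads at \<open>q\<close> and above and writes only below
    \<open>q\<close>, so the source block stays intact.\<close>
  let ?I = "\<lambda>k h. \<exists>a. k = q - a \<and> 20 \<le> a \<and> a \<le> q \<and> h 3 = int a \<and> h 2 = int q \<and> h 5 = 1 \<and>
    (\<forall>c. 20 \<le> c \<longrightarrow> c < a \<longrightarrow> h c = g (q + c)) \<and> (\<forall>c\<ge>q. h c = g c)"
  let ?F = "\<lambda>h. h 2 = int q \<and> (\<forall>c. 20 \<le> c \<longrightarrow> c < q \<longrightarrow> h c = g (q + c)) \<and> (\<forall>c\<ge>q. h c = g c)"
  let ?end = "[Const 1 2, Add 1 1 2, Const 0 0, Add 0 0 2, Load 2 1, Load 0 0, Const 1 0]"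
  let ?B = "[Add 6 3 2, Load 7 6, Store 3 7, Add 3 3 5]"
  show ?thesis unfolding copy_out_def
  proof (rule ensures_Seq[where T = 3 and U = "72 * n + 60" and R = "?I (q - 20)"])
    let ?m = "m(q := int (length J), 2 := int q, 3 := 20)"
    have I: "?I (q - 20) ?m" using q rs by (intro exI[of _ 20]) (auto simp: g_def)
    have eff: "?m = effect [Store 15 16, Add 2 15 9, Const 3 20] m"
      using q by (auto simp: rs s(3,4) fun_eq_iff)
    show "ensures (Blk [Store 15 16, Add 2 15 9, Const 3 20]) m 3 (?I (q - 20))"
    proof (rule ensures_Blk_eq[OF eff])
      show "?I (q - 20) ?m" by (rule I)
    qed simp_all
  next
    fix h assume h: "?I (q - 20) h"
    show "ensures (Seq (Loop 3 2 (Blk ?B)) (Blk (restore [3..<20] @ ?end))) h (72 * n + 60) ?Q"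
    proof (rule ensures_Seq[where T = "72 * n + 2" and U = 58 and R = ?F])
      show "ensures (Loop 3 2 (Blk ?B)) h (72 * n + 2) ?F"
      proof (rule ensures_Loop[where I = ?I and T = 4])
        show "?I (q - 20) h" by (rule h)
      next
        \<comment> \<open>\<open>q\<close> is at most \<open>20 + 12 * n\<close>, so there are at
          most \<open>12 * n\<close> rounds of \<open>6\<close> steps.\<close>
        show "(q - 20) * (4 + 2) + 2 \<le> 72 * n + 2" using s(5) by simp
      next
        fix k h assume I: "?I k h" and lt: "h 3 < h 2"
        obtain a where a: "k = q - a" "20 \<le> a" "a \<le> q" "h 3 = int a" "h 2 = int q" "h 5 = 1"
          "\<And>c. 20 \<le> c \<Longrightarrow> c < a \<Longrightarrow> h c = g (q + c)" "\<And>c. q \<le> c \<Longrightarrow> h c = g c"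
          using I by blast
        have aq: "a < q" using lt a by simp
        let ?h = "h(6 := int (q + a), 7 := h (q + a), a := h (q + a), 3 := int (Suc a))"
        have I': "?I (k - 1) ?h"
          using a(1,2) aq q by (intro exI[of _ "Suc a"]) (auto simp: a(5-8) less_Suc_eq)
        have eff: "?h = effect ?B h"
          using a(2) q by (auto simp: a(4-6) nat_linear fun_eq_iff add.commute)
        have "ensures (Blk ?B) h 4 (?I (k - 1))"
        proof (rule ensures_Blk_eq[OF eff])
          show "?I (k - 1) ?h" by (rule I')
        qed simp_all
        then show "0 < k \<and> ensures (Blk ?B) h 4 (?I (k - 1))" using a(1) aq by simp
      next
        fix k h assume "?I k h" "\<not> h 3 < h 2"
        then show "?F h" by (metis of_nat_less_iff le_neq_implies_less)
      qed
    next
      fix h assume h: "?F h"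
      define h1 where "h1 = effect (restore [3..<20]) h"
      have h1: "h1 c = (if c \<in> {3..<20} then h (q + c) else h c)" if "c \<noteq> 1" for c
        unfolding h1_def using effect_restore[of h q "[3..<20]" c] that h q
        by (simp only: set_upt) simp
      have h1': "h1 2 = int q" "\<And>c. 3 \<le> c \<Longrightarrow> c < q \<Longrightarrow> h1 c = g (q + c)" "\<And>c. q \<le> c \<Longrightarrow> h1 c = g c"
        using h q by (auto simp: h1)
      \<comment> \<open>Cell \<open>2\<close> holds the offset \<open>q\<close>, so the addresses of
        the contents of cells \<open>2\<close> and \<open>0\<close> are formed in cells
        \<open>1\<close> and \<open>0\<close> before it is overwritten; cell \<open>1\<close> is
        cleared last.\<close>
      define h2 where "h2 = effect ?end h1"
      have h2: "h2 0 = g q" "h2 1 = 0" "h2 2 = g (q + 2)" "\<And>c. 3 \<le> c \<Longrightarrow> h2 c = h1 c"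
        using q by (auto simp: h2_def h1'(1) h1'(3) nat_linear add.commute)
      have cells: "h2 c = m (q + c)" if "2 \<le> c" "c < q" for c
        using that h2(3) h2(4)[of c] h1'(2)[of c] by (cases "c = 2") (auto simp: g_def)
      have "exploration n L J" using s(2) by (simp add: max_exploration_def)
      moreover have "3 * length J < q" using s(7) q by simp
      moreover have "h2 0 = int (length J)" using h2(1) by (simp add: g_def)
      ultimately have "dec_output h2 = J" "out_wellformed h2"
        using decode_stack[OF s(6), of n L h2] h2(2) cells by auto
      then have Q: "?Q h2" using s(2) by simp
      have eff: "h2 = effect (restore [3..<20] @ ?end) h" by (simp only: h2_def h1_def effect_simps(3))
      show "ensures (Blk (restore [3..<20] @ ?end)) h 58 ?Q"
      proof (rule ensures_Blk_eq[OF eff])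
        show "?Q h2" by (rule Q)
      qed (simp_all only: list_all_append restore_simps length_append, simp_all)
    qed simp
  qed simp
qed

section \<open>The complete program\<close>

definition solver :: com where
  "solver = Cond 1 0 (Seq copy_in (Seq label_leaves (Seq build (Seq schedule copy_out)))) (Blk [])"

text \<open>Cell \<open>1\<close> is \<open>0\<close> in the input, so the first test asks whether
  \<open>0 < n\<close>; for \<open>n = 0\<close> the memory already encodes the empty exploration.
  The bound adds up the five phases and two steps for the test.\<close>

lemma ensures_solver:
  assumes star: "temporal_star_k n L 2" and k: "n < 2 ^ k"
  shows "ensures solver (enc_input n L) (26 * n * k + 157 * n + 143)
    (\<lambda>m. out_wellformed m \<and> max_exploration n L (dec_output m))" (is "ensures _ _ _ ?Q")
  unfolding solver_def
proof (rule ensures_Cond[where T = "26 * n * k + 157 * n + 141"])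
  assume "enc_input n L 1 < enc_input n L 0"
  then have n: "1 \<le> n" by (simp add: enc_input_def)
  show "ensures (Seq copy_in (Seq label_leaves (Seq build (Seq schedule copy_out)))) (enc_input n L)
    (26 * n * k + 157 * n + 141) ?Q"
  proof (rule ensures_Seq[OF ensures_copy_in, where U = "26 * n * k + 139 * n + 80"])
    fix m assume "copied n L m"
    then show "ensures (Seq label_leaves (Seq build (Seq schedule copy_out))) m (26 * n * k + 139 * n + 80) ?Q"
    proof (rule ensures_Seq[OF ensures_label_leaves, where U = "26 * n * k + 130 * n + 72"])
      fix m assume m: "regs n m \<and> m 4 = int (3 * n) \<and> leaves n L {} m \<and> (\<exists>X. m 8 = int X \<and> bounded_by n L X)"
      then obtain X where X: "m 8 = int X" "bounded_by n L X" by blast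
      have m': "regs n m" "leaves n L {} m" using m by auto
      show "ensures (Seq build (Seq schedule copy_out)) m (26 * n * k + 130 * n + 72) ?Q"
      proof (rule ensures_Seq[OF ensures_build[OF m' n], where U = "26 * n * k + 104 * n + 69"])
        fix m1 assume m1: "regs n m1 \<and> m1 4 = m 4 \<and> m1 8 = m 8 \<and> leaves n L {} m1 \<and> tournament n (node m1) {}"
        have m1': "regs n m1" "m1 4 = int (3 * n)" "m1 8 = int X" "leaves n L {} m1"
          "tournament n (node m1) {}" using m1 m X by auto
        show "ensures (Seq schedule copy_out) m1 (26 * n * k + 104 * n + 69) ?Q"
          by (rule ensures_Seq[OF ensures_schedule[OF star X(2) k n m1'] ensures_copy_out])
            (simp_all add: algebra_simps)
      qed simp
    qed simp
  qed simp
next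
  assume "\<not> enc_input n L 1 < enc_input n L 0"
  then have n: "n = 0" by (simp add: enc_input_def)
  have e: "exploration 0 L J \<longleftrightarrow> J = []" for J
    by (cases J) (auto simp: exploration_def journey_def is_time_edge_def)
  have "enc_input 0 L 0 = 0" by (simp add: enc_input_def)
  then have "?Q (enc_input n L)"
    by (simp add: n out_wellformed_def max_exploration_def e dec_output_def)
  then show "ensures (Blk []) (enc_input n L) (26 * n * k + 157 * n + 141) ?Q"
    by (intro ensures_Blk) simp_all
qed simp

section \<open>From step counts to the logarithmic bound\<close>

lemma half_le_ln_2: "1 / 2 \<le> ln (2 :: real)"
proof -
  \<comment> \<open>Squaring reduces the claim to e being at most 4.\<close>
  have "exp (1 / 2 :: real) ^ 2 = exp 1" by (simp flip: exp_of_nat_mult)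
  also have "\<dots> \<le> (2 :: real) ^ 2" using exp_le by simp
  finally have "exp (1 / 2 :: real) \<le> 2" by (rule power2_le_imp_le) simp
  then show ?thesis by (simp only: ln_ge_iff zero_less_numeral)
qed

lemma exponent_bound:
  assumes "1 \<le> n"
  shows "\<exists>k. n < 2 ^ k \<and> real k \<le> 1 + 2 * ln (real n)"
proof -
  obtain k where k: "2 ^ k \<le> n" "n < 2 ^ (k + 1)" using ex_power_ivl1[of 2 n] assms by auto
  have "real k * ln 2 = ln (2 ^ k)" by (simp add: ln_realpow)
  also have "\<dots> \<le> ln (real n)"
    using k(1) by (subst ln_le_cancel_iff) (use assms in \<open>auto simp flip: of_nat_le_iff\<close>)
  finally have "real k * (1 / 2) \<le> ln (real n)"
    using mult_left_mono[OF half_le_ln_2, of "real k"] by linarith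
  then show ?thesis using k(2) by (intro exI[of _ "k + 1"]) simp
qed

text \<open>For \<open>n \<le> 1\<close> the logarithmic term vanishes and the additive constant has
  to cover up to 326 steps. For larger \<open>n\<close>, the estimate
  \<open>n \<le> 2 * n * ln n\<close> absorbs the linear terms and gives the coefficient
  \<open>52 + 2 * 183 = 418\<close>; 1000 is a round value above both.\<close>

lemma time_bound:
  "\<exists>k. n < 2 ^ k \<and>
    real (26 * n * k + 157 * n + 143) \<le> 1000 * real n * ln (real n) + 1000"
proof (cases "n \<le> 1")
  case True
  then consider "n = 0" | "n = 1" by linarith
  then show ?thesis by cases (auto intro: exI[of _ 0] exI[of _ 1])
next
  case False
  then obtain k where k: "n < 2 ^ k" "real k \<le> 1 + 2 * ln (real n)" using exponent_bound[of n] by auto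
  have "ln 2 \<le> ln (real n)" using False by (subst ln_le_cancel_iff) auto
  then have "1 \<le> 2 * ln (real n)" using half_le_ln_2 by linarith
  then have a: "real n \<le> 2 * (real n * ln (real n))" using mult_left_mono[of 1 "2 * ln (real n)" "real n"] by simp
  have b: "real n * real k \<le> real n + 2 * (real n * ln (real n))"
    using mult_left_mono[OF k(2), of "real n"] by (simp add: algebra_simps)
  have "real (26 * n * k + 157 * n + 143) = 26 * (real n * real k) + 157 * real n + 143" by simp
  also have "\<dots> \<le> 1000 * real n * ln (real n) + 1000" using a b by linarith
  finally show ?thesis using k(1) by blast
qed

theorem theorem1:
  shows "\<exists>(P :: instr list) (C :: real). \<forall>(n :: nat) (L :: nat \<Rightarrow> nat set).
     temporal_star_k n L 2 \<longrightarrow>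
       (\<exists>t. real t \<le> C * real n * ln (real n) + C
            \<and> halts_within P t (enc_input n L)
            \<and> out_wellformed (snd (run P t (enc_input n L)))
            \<and> max_exploration n L (dec_output (snd (run P t (enc_input n L)))))"
proof (rule exI[of _ "compile solver 0"], rule exI[of _ 1000], intro allI impI)
  fix n :: nat and L :: "nat \<Rightarrow> nat set"
  assume star: "temporal_star_k n L 2"
  obtain k where k: "n < 2 ^ k"
    "real (26 * n * k + 157 * n + 143) \<le> 1000 * real n * ln (real n) + 1000"
    using time_bound by blast
  obtain t where t: "t \<le> 26 * n * k + 157 * n + 143"
    "halts_within (compile solver 0) t (enc_input n L)"
    "out_wellformed (snd (run (compile solver 0) t (enc_input n L)))"
    "max_exploration n L (dec_output (snd (run (compile solver 0) t (enc_input n L))))"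
    using ensures_run[OF ensures_solver[OF star k(1)]] by blast
  have "real t \<le> 1000 * real n * ln (real n) + 1000"
    using k(2) of_nat_mono[OF t(1), where 'a = real] by linarith
  then show "\<exists>t. real t \<le> 1000 * real n * ln (real n) + 1000
            \<and> halts_within (compile solver 0) t (enc_input n L)
            \<and> out_wellformed (snd (run (compile solver 0) t (enc_input n L)))
            \<and> max_exploration n L (dec_output (snd (run (compile solver 0) t (enc_input n L))))"
    using t(2-4) by blast
qed

end
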